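(* Let $p>0$. (1) For all $f\in L^1_{loc}(0,\infty)$ with $x^{-p+1}|f|^2\in L^1(0,\infty)$ the following equalities hold: $$\left(\frac p2\right)^2\int_0^\infty x^{-p+1}\left|\frac1x\int_0^x f(y)\,dy\right|^2dx=\int_0^\infty x^{-p+1}|f(x)|^2dx-\int_0^\infty x^{-p+1}\left|f(x)-\frac{p}{2x}\int_0^x f(y)\,dy\right|^2dx$$ $$=\int_0^\infty x^{-p+1}|f(x)|^2dx-\int_0^\infty x\left|\frac{d}{dx}\left(x^{-\frac p2}\int_0^x f(y)\,dy\right)\right|^2dx .$$ Moreover, the second term $\int_0^\infty x^{-p+1}\left|f(x)-\frac{p}{2x}\int_0^x f(y)\,dy\right|^2dx$ vanishes if and only if $\int_0^x f(y)\,dy=c\,x^{\frac p2}$ (for all $x>0$) for some $c\in\mathbb{C}$; a function $f$ of this form makes the left-hand side infinite unless $c=0$, that is, for $c\neq0$, $$x^{-p+1}\left|\frac1x\int_0^x f(y)\,dy\right|^2=|c|^2x^{-1}\notin L^1(0,\infty).$$ (2) For all $f\in L^1_{loc}(0,\infty)$ with $x^{p+1}|f|^2\in L^1(0,\infty)$ the following equalities hold: $$\left(\frac p2\right)^2\int_0^\infty x^{p+1}\left|\frac1x\int_x^\infty f(y)\,dy\right|^2dx=\int_0^\infty x^{p+1}|f(x)|^2dx-\int_0^\infty x^{p+1}\left|f(x)-\frac{p}{2x}\int_x^\infty f(y)\,dy\right|^2dx$$ $$=\int_0^\infty x^{p+1}|f(x)|^2dx-\int_0^\infty x\left|\frac{d}{dx}\left(x^{\frac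 p2}\int_x^\infty f(y)\,dy\right)\right|^2dx .$$ Moreover, the second term $\int_0^\infty x^{p+1}\left|f(x)-\frac{p}{2x}\int_x^\infty f(y)\,dy\right|^2dx$ vanishes if and only if $\int_x^\infty f(y)\,dy=c\,x^{-\frac p2}$ (for all $x>0$) for some $c\in\mathbb{C}$; a function $f$ of this form makes the left-hand side infinite unless $c=0$, that is, for $c\neq0$, $$x^{p+1}\left|\frac1x\int_x^\infty f(y)\,dy\right|^2=|c|^2x^{-1}\notin L^1(0,\infty).$$
   Context: Functions on $(0,\infty)$ are complex-valued and measurable; integrals are Lebesgue integrals and $\frac{d}{dx}$ of an integral function is understood almost everywhere. *)

theory Defs
  imports "HOL-Analysis.Analysis"
begin

text \<open>Local integrability on \<open>S\<close>. Functions are total, but only their values on \<open>S\<close> matter;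
  measurability is Lebesgue (not merely Borel) measurability.\<close>

definition locally_L1 :: "real set \<Rightarrow> (real \<Rightarrow> complex) \<Rightarrow> bool" where
  "locally_L1 S f \<longleftrightarrow>
     set_borel_measurable lebesgue S f \<and>
     (\<forall>K. compact K \<and> K \<subseteq> S \<longrightarrow> set_integrable lebesgue K f)"

text \<open>The Bochner integral of a non-integrable function is \<open>0\<close> by convention, so the two
  operators below are meaningful only together with integrability on \<open>{0<..<x}\<close>,
  respectively \<open>{x<..}\<close>.\<close>

definition int_from_zero :: "(real \<Rightarrow> complex) \<Rightarrow> real \<Rightarrow> complex" where
  "int_from_zero f x = (LINT y:{0<..<x}|lebesgue. f y)"

definition int_to_infinity :: "(real \<Rightarrow> complex) \<Rightarrow> real \<Rightarrow> complex" where
  "int_to_infinity f x = (LINT y:{x<..}|lebesgue. f y)"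

end

theory Submission
  imports Defs
begin

text \<open>
  Put \<open>\<sigma> = 1\<close> and \<open>F x = \<integral>\<^sub>0\<^sup>x f\<close> in part (1), \<open>\<sigma> = -1\<close> and \<open>F x = \<integral>\<^sub>x\<^sup>\<infinity> f\<close> in part (2), so that
  \<open>F' = \<sigma> f\<close> almost everywhere. With \<open>H = x\<^bsup>-\<sigma>p/2\<^esup> F\<close> and \<open>k = x\<^bsup>-\<sigma>p/2\<^esup> (f - p F / (2x))\<close> one has
  \<open>H' = \<sigma> k\<close> almost everywhere, and expanding the square of \<open>x\<^bsup>-\<sigma>p/2\<^esup> f = k + p H / (2x)\<close> gives
  \<open>x\<^bsup>1-\<sigma>p\<^esup> |f|\<^sup>2 = x |k|\<^sup>2 + (\<sigma>p/2) (|H|\<^sup>2)' + (p/2)\<^sup>2 |H|\<^sup>2 / x\<close>.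
  Since \<open>H\<close> is bounded, integrating over compact intervals bounds the two nonnegative terms.
  Then \<open>|H|\<^sup>2 / x\<close> is integrable near \<open>0\<close> and \<open>\<infinity>\<close> while \<open>1 / x\<close> is not, so \<open>H\<close> gets arbitrarily small
  there and the boundary terms vanish along suitable sequences. The remainder is zero iff \<open>k = 0\<close>
  almost everywhere iff \<open>H\<close> is constant.
\<close>

subsection \<open>Indefinite Lebesgue integrals\<close>

text \<open>Lebesgue differentiation for gauge integrals, the setting in which Henstock's lemma
  lives. It is the source of the almost everywhere derivative of \<open>H\<close>.\<close>

lemma negligible_not_has_vector_derivative_integral:
  fixes f :: "real \<Rightarrow> 'a::euclidean_space"
  assumes f: "f integrable_on {a..b}"
  shows "negligible {x \<in> {a<..<b}. \<not> ((\<lambda>t. integral {a..t} f) has_vector_derivative f x) (at x)}"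
proof -
  define F where "F t = integral {a..t} f" for t
  define bad where "bad e x y \<longleftrightarrow> y \<in> {a..b} \<and> y \<noteq> x \<and> e * \<bar>y - x\<bar> < norm (F y - F x - (y - x) *\<^sub>R f x)" for e x y
  \<comment> \<open>By Henstock's lemma the disjoint intervals witnessing failure of differentiability, tagged at
    an endpoint, have small total length; Vitali's theorem lets them cover almost all of \<open>E e\<close>.\<close>
  define E where "E e = {x \<in> {a<..<b}. \<forall>d>0. \<exists>y. \<bar>y - x\<bar> < d \<and> bad e x y}" for e
  have F_diff: "integral {s..t} f = F t - F s" if "a \<le> s" "s \<le> t" "t \<le> b" for s t
  proof -
    have "f integrable_on {a..t}"
      using f that by (auto intro: integrable_on_subinterval)
    from Henstock_Kurzweil_Integration.integral_combine[OF that(1,2) this] show ?thesis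
      by (simp add: F_def algebra_simps)
  qed
  have neg: "negligible (E e)" if "e > 0" for e
    unfolding negligible_outer_le
  proof (intro allI impI)
    fix \<eta> :: real assume "\<eta> > 0"
    with \<open>e > 0\<close> have "e * \<eta> > 0" by simp
    moreover have "f integrable_on cbox a b" using f by simp
    ultimately obtain \<gamma> where \<gamma>: "gauge \<gamma>"
      and \<gamma>_sum: "\<And>p. \<lbrakk>p tagged_partial_division_of (cbox a b); \<gamma> fine p\<rbrakk> \<Longrightarrow>
                   (\<Sum>(x,k)\<in>p. norm (measure lborel k *\<^sub>R f x - integral k f)) < e * \<eta>"
      using Henstock_lemma[of f a b "e * \<eta>"] by blast
    \<comment> \<open>A pair \<open>z = (x, y)\<close> stands for the interval between the tag
      \<open>x\<close> and the point \<open>y\<close>, in either order; \<open>c\<close> and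
      \<open>r\<close> present it as a ball, as Vitali's theorem requires.\<close>
    define c where "c z = (fst z + snd z) / 2" for z :: "real \<times> real"
    define r where "r z = \<bar>snd z - fst z\<bar> / 2" for z :: "real \<times> real"
    have cb: "cball (c z) (r z) = {min (fst z) (snd z)..max (fst z) (snd z)}" for z
      by (auto simp: c_def r_def cball_eq_atLeastAtMost min_def max_def field_simps)
    define K where "K = {z. fst z \<in> {a<..<b} \<and> bad e (fst z) (snd z) \<and> cball (c z) (r z) \<subseteq> \<gamma> (fst z)}"
    have cover: "\<exists>z. z \<in> K \<and> x \<in> cball (c z) (r z) \<and> r z < d" if x: "x \<in> E e" and "d > 0" for x d
    proof -
      obtain d' where d': "d' > 0" "ball x d' \<subseteq> \<gamma> x"
        using openE[of "\<gamma> x" x] gaugeD[OF \<gamma>, of x] by blast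
      have "min d d' > 0" using \<open>d > 0\<close> d' by simp
      then obtain y where y: "\<bar>y - x\<bar> < min d d'" "bad e x y"
        using x unfolding E_def by blast
      have "cball (c (x,y)) (r (x,y)) \<subseteq> ball x d'"
        using y unfolding cb by (auto simp: dist_real_def)
      then have "(x, y) \<in> K" using x y d' by (auto simp: K_def E_def)
      moreover have "x \<in> cball (c (x,y)) (r (x,y))" unfolding cb by auto
      moreover have "r (x,y) < d" using y \<open>d > 0\<close> by (auto simp: r_def)
      ultimately show ?thesis by blast
    qed
    have r_pos: "0 < r z" if "z \<in> K" for z
      using that by (auto simp: K_def bad_def r_def)
    obtain C where C: "countable C" "C \<subseteq> K"
      "pairwise (\<lambda>i j. disjnt (cball (c i) (r i)) (cball (c j) (r j))) C"
      "negligible (E e - (\<Union>i\<in>C. cball (c i) (r i)))"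
      by (rule Vitali_covering_theorem_cballs[of K r "E e" c, OF r_pos cover])
    define U where "U = (\<Union>i\<in>C. cball (c i) (r i))"
    \<comment> \<open>Henstock's bound concerns finite families only; being uniform in
      \<open>D\<close>, it passes to the countable union \<open>U\<close>.\<close>
    have fin: "measure lebesgue (\<Union>i\<in>D. cball (c i) (r i)) \<le> \<eta>" if D: "D \<subseteq> C" "finite D" for D
    proof -
      define g where "g z = (fst z, cball (c z) (r z))" for z
      have in_ab: "cball (c z) (r z) \<subseteq> {a..b}" if "z \<in> D" for z
        using that D C(2) unfolding cb by (auto simp: K_def bad_def)
      have disj: "cball (c z) (r z) \<inter> cball (c w) (r w) = {}" if "z \<in> D" "w \<in> D" "z \<noteq> w" for z w
        using that D C(3) by (auto simp: pairwise_def disjnt_def)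
      have ne: "fst z \<in> cball (c z) (r z)" for z unfolding cb by auto
      \<comment> \<open>Disjoint intervals that contain their tags are distinct, so the sum over
        \<open>D\<close> may be reindexed by the tagged intervals.\<close>
      have inj: "inj_on g D"
        unfolding inj_on_def g_def by (metis IntI disj empty_iff ne prod.inject)
      have tag: "g ` D tagged_partial_division_of cbox a b"
        unfolding tagged_partial_division_of_def
      proof (intro conjI allI impI)
        show "finite (g ` D)" using D by simp
      next
        fix x k assume "(x, k) \<in> g ` D"
        then obtain z where z: "z \<in> D" "x = fst z" "k = cball (c z) (r z)" by (auto simp: g_def)
        show "x \<in> k" using ne z by simp
        show "k \<subseteq> cbox a b" using in_ab z by simp
        show "\<exists>u v. k = cbox u v" unfolding z cb by auto
      next
        fix x1 k1 x2 k2 assume *: "(x1, k1) \<in> g ` D \<and> (x2, k2) \<in> g ` D \<and> (x1, k1) \<noteq> (x2, k2)"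
        then obtain z w where zw: "z \<in> D" "w \<in> D" "z \<noteq> w"
          "k1 = cball (c z) (r z)" "k2 = cball (c w) (r w)"
          unfolding g_def by blast
        have "k1 \<inter> k2 = {}" unfolding zw(4,5) by (rule disj[OF zw(1-3)])
        then show "interior k1 \<inter> interior k2 = {}"
          using interior_subset by blast
      qed
      have fine: "\<gamma> fine g ` D"
        using D C(2) by (auto simp: fine_def g_def K_def)
      \<comment> \<open>By \<open>bad\<close>, each chosen interval contributes at least
        \<open>e\<close> times its length to the Henstock sum.\<close>
      have *: "e * measure lebesgue (cball (c z) (r z))
            \<le> norm (measure lborel (cball (c z) (r z)) *\<^sub>R f (fst z) - integral (cball (c z) (r z)) f)"
        if "z \<in> D" for z
      proof -
        obtain x y where z: "z = (x, y)" by fastforce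
        have xy: "x \<in> {a<..<b}" "bad e x y" using that D C(2) z by (auto simp: K_def)
        show ?thesis
        proof (cases "x < y")
          case True
          then show ?thesis using xy F_diff[of x y]
            unfolding cb z by (auto simp: bad_def norm_minus_commute)
        next
          case False
          then have "y < x" using xy by (auto simp: bad_def)
          \<comment> \<open>When the tag is the right endpoint, both the increment and the linear
            term change sign, which the norm does not see.\<close>
          have "norm (F y - F x - (y - x) *\<^sub>R f x) = norm ((x - y) *\<^sub>R f x - (F x - F y))"
            by (rule arg_cong[where f = norm]) (simp add: algebra_simps)
          with \<open>y < x\<close> show ?thesis using xy F_diff[of y x]
            unfolding cb z by (auto simp: bad_def)
        qed
      qed
      have "e * measure lebesgue (\<Union>i\<in>D. cball (c i) (r i)) \<le> e * (\<Sum>i\<in>D. measure lebesgue (cball (c i) (r i)))"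
        using \<open>e > 0\<close> D by (intro mult_left_mono measure_UNION_le) auto
      also have "\<dots> \<le> (\<Sum>z\<in>D. norm (measure lborel (cball (c z) (r z)) *\<^sub>R f (fst z) - integral (cball (c z) (r z)) f))"
        unfolding sum_distrib_left by (intro sum_mono *)
      also have "\<dots> = (\<Sum>(x,k)\<in>g ` D. norm (measure lborel k *\<^sub>R f x - integral k f))"
        unfolding sum.reindex[OF inj] by (simp add: g_def)
      also have "\<dots> < e * \<eta>" by (rule \<gamma>_sum[OF tag fine])
      finally show ?thesis using \<open>e > 0\<close> by simp
    qed
    have U: "U \<in> lmeasurable" "measure lebesgue U \<le> \<eta>"
      unfolding U_def
      by (rule fmeasurable_UN_bound[OF C(1) lmeasurable_cball fin]
          measure_UN_bound[OF C(1) lmeasurable_cball fin]; assumption)+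
    have "E e \<subseteq> U \<union> (E e - U)" by blast
    moreover have "U \<union> (E e - U) \<in> lmeasurable"
      using U(1) negligible_imp_measurable[OF C(4)] unfolding U_def[symmetric] by (rule fmeasurable.Un)
    moreover have "measure lebesgue (U \<union> (E e - U)) \<le> \<eta>"
      using U C(4) unfolding U_def[symmetric] negligible_iff_null_sets
      by (subst measure_Un_null_set) (auto simp: fmeasurableD)
    ultimately show "\<exists>T. E e \<subseteq> T \<and> T \<in> lmeasurable \<and> measure lebesgue T \<le> \<eta>" by blast
  qed
  \<comment> \<open>Failure of the derivative is visible at some rate \<open>1 / Suc n\<close>, so
    countably many null sets cover the exceptional points.\<close>
  have "{x \<in> {a<..<b}. \<not> (F has_vector_derivative f x) (at x)} \<subseteq> (\<Union>n. E (1 / Suc n))"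
  proof (rule subsetI, rule ccontr)
    fix x assume "x \<in> {x \<in> {a<..<b}. \<not> (F has_vector_derivative f x) (at x)}"
      and "x \<notin> (\<Union>n. E (1 / Suc n))"
    then have x: "a < x" "x < b" and not: "\<not> (F has_vector_derivative f x) (at x)"
      and notE: "\<And>n. x \<notin> E (1 / Suc n)" by auto
    have "(F has_vector_derivative f x) (at x)"
      unfolding has_vector_derivative_def has_derivative_within_alt
    proof (intro conjI allI impI)
      show "bounded_linear (\<lambda>h. h *\<^sub>R f x)" by (rule bounded_linear_scaleR_left)
      fix e :: real assume "e > 0"
      then obtain n where n: "1 / Suc n < e" using nat_approx_posE by auto
      obtain d where d: "d > 0" "\<And>y. \<bar>y - x\<bar> < d \<Longrightarrow> \<not> bad (1 / Suc n) x y"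
        using notE[of n] x by (auto simp: E_def)
      show "\<exists>d>0. \<forall>y\<in>UNIV. norm (y - x) < d \<longrightarrow> norm (F y - F x - (y - x) *\<^sub>R f x) \<le> e * norm (y - x)"
      proof (intro exI conjI ballI impI)
        \<comment> \<open>The radius also keeps \<open>y\<close> inside \<open>{a..b}\<close>; hence
          \<open>bad\<close> can fail only through its inequality or because
          \<open>y = x\<close>.\<close>
        show "min d (min (x - a) (b - x)) > 0" using d x by auto
        fix y assume y: "norm (y - x) < min d (min (x - a) (b - x))"
        then have "\<not> bad (1 / Suc n) x y" and "y \<in> {a..b}" using d by auto
        then have "norm (F y - F x - (y - x) *\<^sub>R f x) \<le> 1 / Suc n * \<bar>y - x\<bar>"
          by (cases "y = x") (auto simp: bad_def)
        also have "\<dots> \<le> e * norm (y - x)" using mult_right_mono[of "1 / Suc n" e "norm (y - x)"] n by simp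
        finally show "norm (F y - F x - (y - x) *\<^sub>R f x) \<le> e * norm (y - x)" .
      qed
    qed
    with not show False by contradiction
  qed
  moreover have "negligible (\<Union>n. E (1 / Suc n))"
    by (intro negligible_countable_Union) (auto intro: neg)
  ultimately show ?thesis
    unfolding F_def by (rule negligible_subset[rotated])
qed

section \<open>Integration by parts through Fubini's theorem\<close>

lemma set_integral_lebesgue_combine:
  fixes f :: "real \<Rightarrow> 'a::euclidean_space"
  assumes "a \<le> c" "c \<le> b" and f: "set_integrable lebesgue {a..b} f"
  shows "(LINT x:{a..c}|lebesgue. f x) + (LINT x:{c..b}|lebesgue. f x) = (LINT x:{a..b}|lebesgue. f x)"
proof -
  have "set_integrable lebesgue {a..c} f" "set_integrable lebesgue {c..b} f"
    using assms by (auto intro: set_integrable_subset[OF f])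
  with f show ?thesis
    using Henstock_Kurzweil_Integration.integral_combine[OF assms(1,2) set_lebesgue_integral_eq_integral(1)[OF f]]
    by (simp add: set_lebesgue_integral_eq_integral)
qed

text \<open>The kernel is dominated by a constant times the product of the norms, which is
  integrable over the product measure. A general bilinear product covers both scalar multiplication
  and the inner product.\<close>

lemma bounded_bilinear_integrable_pair_measure:
  fixes mul :: "'a::{banach,second_countable_topology} \<Rightarrow> 'b::{banach,second_countable_topology}
      \<Rightarrow> 'c::{banach,second_countable_topology}"
  assumes "bounded_bilinear mul" "sigma_finite_measure M" "sigma_finite_measure N"
    and u: "integrable M u" and v: "integrable N v"
  shows "integrable (M \<Otimes>\<^sub>M N) (\<lambda>z. mul (u (fst z)) (v (snd z)))"
proof -
  interpret mul: bounded_bilinear mul by fact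
  interpret pair_sigma_finite M N using assms by (simp add: pair_sigma_finite_def)
  have [measurable]: "u \<in> borel_measurable M" "v \<in> borel_measurable N"
    using u v by auto
  obtain K where K: "K > 0" "\<And>x y. norm (mul x y) \<le> norm x * norm y * K"
    using mul.pos_bounded by blast
  have "integrable (M \<Otimes>\<^sub>M N) (\<lambda>z. norm (u (fst z)) * norm (v (snd z)))"
    using u v by (intro Fubini_integrable) auto
  then have "integrable (M \<Otimes>\<^sub>M N) (\<lambda>z. norm (u (fst z)) * norm (v (snd z)) * K)"
    by simp
  moreover have "(\<lambda>z. mul (u (fst z)) (v (snd z))) \<in> borel_measurable (M \<Otimes>\<^sub>M N)"
    by (rule borel_measurable_continuous_Pair) (auto intro!: mul.continuous_on continuous_intros)
  ultimately show ?thesis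
    by (rule Bochner_Integration.integrable_bound) (auto intro!: order_trans[OF K(2)])
qed

text \<open>\<open>U\<close> and \<open>V\<close> need not be differentiable everywhere, so the product rule is replaced by Fubini's
  theorem for \<open>u x \<cdot> v y\<close> on the triangle \<open>a \<le> y \<le> x \<le> b\<close>.\<close>

lemma integration_by_parts_lebesgue:
  fixes mul :: "'a::euclidean_space \<Rightarrow> 'b::euclidean_space \<Rightarrow> 'c::euclidean_space"
    and a b :: real
  assumes bil: "bounded_bilinear mul" and "a \<le> b"
    and u: "set_integrable lebesgue {a..b} u" and v: "set_integrable lebesgue {a..b} v"
    and U: "\<And>x. x \<in> {a..b} \<Longrightarrow> U x - U a = (LINT y:{a..x}|lebesgue. u y)"
    and V: "\<And>x. x \<in> {a..b} \<Longrightarrow> V x - V a = (LINT y:{a..x}|lebesgue. v y)"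
  shows "set_integrable lebesgue {a..b} (\<lambda>x. mul (u x) (V x) + mul (U x) (v x))"
    and "(LINT x:{a..b}|lebesgue. mul (u x) (V x) + mul (U x) (v x)) = mul (U b) (V b) - mul (U a) (V a)"
proof -
  interpret mul: bounded_bilinear mul by fact
  define M where "M = lebesgue_on {a..b}"
  interpret M: finite_measure M unfolding M_def by (rule finite_measure_lebesgue_on) simp
  interpret P: pair_sigma_finite M M ..
  have space_M: "space M = {a..b}" by (simp add: M_def)
  have uM: "integrable M u" and vM: "integrable M v"
    using u v by (simp_all add: M_def integrable_restrict_space set_integrable_def)
  have id_M [measurable]: "(\<lambda>x. x) \<in> borel_measurable M"
    unfolding M_def by (intro measurable_restrict_space1 measurable_completion) simp
  have ind: "integrable M (\<lambda>x. indicat_real S x *\<^sub>R w x)"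
    if "integrable M w" "S \<in> sets borel" for S and w :: "real \<Rightarrow> 'd::euclidean_space"
  proof (rule Bochner_Integration.integrable_bound[OF that(1)])
    show "(\<lambda>x. indicat_real S x *\<^sub>R w x) \<in> borel_measurable M"
      using that by (intro borel_measurable_scaleR measurable_compose[OF id_M borel_measurable_indicator]) auto
  qed (auto simp: indicator_def)
  have meas: "(\<lambda>z. indicat_real {z. snd z \<le> fst z} z) \<in> borel_measurable (M \<Otimes>\<^sub>M M)"
    by measurable
  \<comment> \<open>\<open>k\<close> is the Fubini integrand, cut off to the triangle; its slices
    integrate to increments of \<open>V\<close> from the left end and of \<open>U\<close> to the
    right end.\<close>
  define k where "k z = indicat_real {z. snd z \<le> fst z} z *\<^sub>R mul (u (fst z)) (v (snd z))" for z
  have k: "integrable (M \<Otimes>\<^sub>M M) k"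
  proof (rule Bochner_Integration.integrable_bound)
    show uv: "integrable (M \<Otimes>\<^sub>M M) (\<lambda>z. mul (u (fst z)) (v (snd z)))"
      using uM vM by (intro bounded_bilinear_integrable_pair_measure bil) (auto simp: M.sigma_finite_measure_axioms)
    show "k \<in> borel_measurable (M \<Otimes>\<^sub>M M)"
      unfolding k_def using meas uv by (intro borel_measurable_scaleR) auto
  qed (auto simp: k_def indicator_def)
  have int_M: "integral\<^sup>L M f = (LINT x:{a..b}|lebesgue. f x)" for f :: "real \<Rightarrow> 'c"
    unfolding M_def set_lebesgue_integral_def by (rule integral_restrict_space) simp
  have V': "(\<integral>y. indicat_real {..x} y *\<^sub>R v y \<partial>M) = V x - V a" if "x \<in> {a..b}" for x
    unfolding V[OF that] M_def set_lebesgue_integral_def using that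
    by (subst integral_restrict_space) (auto intro!: Bochner_Integration.integral_cong simp: indicator_def)
  have U': "(\<integral>x. indicat_real {y..} x *\<^sub>R u x \<partial>M) = U b - U y" if "y \<in> {a..b}" for y
  proof -
    have "(\<integral>x. indicat_real {y..} x *\<^sub>R u x \<partial>M) = (LINT x:{y..b}|lebesgue. u x)"
      unfolding M_def set_lebesgue_integral_def using that
      by (subst integral_restrict_space) (auto intro!: Bochner_Integration.integral_cong simp: indicator_def)
    then show ?thesis
      using U[of y] U[of b] that set_integral_lebesgue_combine[of a y b u] u by (auto simp: algebra_simps)
  qed
  have eq1: "(\<integral>y. k (x, y) \<partial>M) = mul (u x) (V x - V a)" if "x \<in> {a..b}" for x
  proof -
    have "(\<integral>y. k (x, y) \<partial>M) = (\<integral>y. mul (u x) (indicat_real {..x} y *\<^sub>R v y) \<partial>M)"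
      by (intro Bochner_Integration.integral_cong) (auto simp: k_def indicator_def mul.zero_right)
    also have "\<dots> = mul (u x) (\<integral>y. indicat_real {..x} y *\<^sub>R v y \<partial>M)"
      by (intro integral_bounded_linear mul.bounded_linear_right ind vM) auto
    finally show ?thesis using V' that by simp
  qed
  have eq2: "(\<integral>x. k (x, y) \<partial>M) = mul (U b - U y) (v y)" if "y \<in> {a..b}" for y
  proof -
    have "(\<integral>x. k (x, y) \<partial>M) = (\<integral>x. mul (indicat_real {y..} x *\<^sub>R u x) (v y) \<partial>M)"
      by (intro Bochner_Integration.integral_cong) (auto simp: k_def indicator_def mul.zero_left)
    also have "\<dots> = mul (\<integral>x. indicat_real {y..} x *\<^sub>R u x \<partial>M) (v y)"
      by (intro integral_bounded_linear mul.bounded_linear_left ind uM) auto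
    finally show ?thesis using U' that by simp
  qed
  have i1: "integrable M (\<lambda>x. mul (u x) (V x - V a))"
    using P.integrable_fst'[OF k] by (rule Bochner_Integration.integrable_cong[THEN iffD1, rotated -1]) (auto simp: space_M eq1)
  have i2: "integrable M (\<lambda>x. mul (U b - U x) (v x))"
    using P.integrable_snd[of "\<lambda>x y. k (x,y)"] k 
    by (subst Bochner_Integration.integrable_cong[OF refl]) (auto simp: space_M eq2)
  have "(\<integral>x. mul (u x) (V x - V a) \<partial>M) = (\<integral>x. (\<integral>y. k (x, y) \<partial>M) \<partial>M)"
    by (intro Bochner_Integration.integral_cong) (auto simp: eq1 space_M)
  also have "\<dots> = (\<integral>y. (\<integral>x. k (x, y) \<partial>M) \<partial>M)"
    using P.Fubini_integral[of "\<lambda>x y. k (x,y)"] k by simp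
  also have "\<dots> = (\<integral>x. mul (U b - U x) (v x) \<partial>M)"
    by (intro Bochner_Integration.integral_cong) (auto simp: eq2 space_M)
  finally have eq: "(\<integral>x. mul (u x) (V x - V a) \<partial>M) = (\<integral>x. mul (U b - U x) (v x) \<partial>M)" .
  have c1: "integrable M (\<lambda>x. mul (u x) (V a))" and c2: "integrable M (\<lambda>x. mul (U b) (v x))"
    using uM vM by (auto intro: integrable_bounded_linear mul.bounded_linear_left mul.bounded_linear_right)
  \<comment> \<open>The constants \<open>V a\<close> and \<open>U b\<close> absent from the two
    iterated integrals are added back. After integration the first and last terms cancel by
    \<open>eq\<close>, and only boundary values remain.\<close>
  have expand: "mul (u x) (V x) + mul (U x) (v x)
      = (mul (u x) (V x - V a) + mul (u x) (V a)) + (mul (U b) (v x) - mul (U b - U x) (v x))" for x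
    by (simp add: mul.diff_left mul.diff_right)
  have int: "integrable M (\<lambda>x. mul (u x) (V x) + mul (U x) (v x))"
    unfolding expand using i1 i2 c1 c2 by simp
  then show "set_integrable lebesgue {a..b} (\<lambda>x. mul (u x) (V x) + mul (U x) (v x))"
    by (simp add: M_def integrable_restrict_space set_integrable_def)
  have tot: "(\<integral>x. u x \<partial>M) = U b - U a" "(\<integral>x. v x \<partial>M) = V b - V a"
    using U[of b] V[of b] \<open>a \<le> b\<close> unfolding M_def set_lebesgue_integral_def
    by (auto simp: integral_restrict_space)
  have "(\<integral>x. mul (u x) (V x) + mul (U x) (v x) \<partial>M)
      = (\<integral>x. mul (u x) (V a) \<partial>M) + (\<integral>x. mul (U b) (v x) \<partial>M)"
    unfolding expand using i1 i2 c1 c2 eq by simp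
  also have "\<dots> = mul (U b - U a) (V a) + mul (U b) (V b - V a)"
    using integral_bounded_linear[OF mul.bounded_linear_left uM] integral_bounded_linear[OF mul.bounded_linear_right vM] tot
    by simp
  also have "\<dots> = mul (U b) (V b) - mul (U a) (V a)"
    by (simp add: mul.diff_left mul.diff_right)
  finally show "(LINT x:{a..b}|lebesgue. mul (u x) (V x) + mul (U x) (v x)) = mul (U b) (V b) - mul (U a) (V a)"
    by (simp add: int_M)
qed

section \<open>Primitives on the open half-line\<close>

text \<open>Local absolute continuity in integral form. Only increments between positive points are
  constrained, so the additive constant and the behaviour at 0 stay free. The form is closed under
  bilinear products and yields continuity and a derivative almost everywhere.\<close>

definition lebesgue_primitive :: "(real \<Rightarrow> 'a::euclidean_space) \<Rightarrow> (real \<Rightarrow> 'a) \<Rightarrow> bool" where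
  "lebesgue_primitive f G \<longleftrightarrow> (\<forall>a b. 0 < a \<longrightarrow> a \<le> b \<longrightarrow>
     set_integrable lebesgue {a..b} f \<and> G b - G a = (LINT y:{a..b}|lebesgue. f y))"

lemma lebesgue_primitive_cong:
  assumes prim: "lebesgue_primitive f G" and f: "\<And>x. 0 < x \<Longrightarrow> f x = f' x" and G: "\<And>x. 0 < x \<Longrightarrow> G x = G' x"
  shows "lebesgue_primitive f' G'"
  unfolding lebesgue_primitive_def
proof (intro allI impI)
  fix a b :: real assume ab: "0 < a" "a \<le> b"
  have "set_integrable lebesgue {a..b} f = set_integrable lebesgue {a..b} f'"
    using ab f by (intro set_integrable_cong) auto
  moreover have "(LINT y:{a..b}|lebesgue. f y) = (LINT y:{a..b}|lebesgue. f' y)"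
    using ab f by (intro set_lebesgue_integral_cong) auto
  moreover have "set_integrable lebesgue {a..b} f \<and> G b - G a = (LINT y:{a..b}|lebesgue. f y)"
    using prim ab unfolding lebesgue_primitive_def by blast
  moreover have "G b = G' b" "G a = G' a" using ab by (auto intro: G)
  ultimately show "set_integrable lebesgue {a..b} f' \<and> G' b - G' a = (LINT y:{a..b}|lebesgue. f' y)"
    by simp
qed

lemma lebesgue_primitive_smooth:
  assumes "\<And>x. 0 < x \<Longrightarrow> (U has_vector_derivative u x) (at x)" and "continuous_on {0<..} u"
  shows "lebesgue_primitive u U"
  unfolding lebesgue_primitive_def
proof (intro allI impI conjI)
  fix a b :: real assume ab: "0 < a" "a \<le> b"
  show int: "set_integrable lebesgue {a..b} u"
    using ab by (intro absolutely_integrable_continuous_real continuous_on_subset[OF assms(2)]) auto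
  have "(u has_integral (U b - U a)) {a..b}"
  proof (rule fundamental_theorem_of_calculus)
    show "(U has_vector_derivative u x) (at x within {a..b})" if "x \<in> {a..b}" for x
      using ab that by (auto intro: has_vector_derivative_at_within[OF assms(1)])
  qed (use ab in simp)
  then show "U b - U a = (LINT y:{a..b}|lebesgue. u y)"
    using set_lebesgue_integral_eq_integral[OF int] by (simp add: integral_unique)
qed

text \<open>The product rule, used with scalar multiplication to form \<open>H\<close> and with the
  inner product to form \<open>(cmod (H x))\<^sup>2\<close>.\<close>

lemma lebesgue_primitive_bilinear:
  fixes mul :: "'a::euclidean_space \<Rightarrow> 'b::euclidean_space \<Rightarrow> 'c::euclidean_space"
  assumes "bounded_bilinear mul" and u: "lebesgue_primitive u U" and v: "lebesgue_primitive v V"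
  shows "lebesgue_primitive (\<lambda>x. mul (u x) (V x) + mul (U x) (v x)) (\<lambda>x. mul (U x) (V x))"
  unfolding lebesgue_primitive_def
proof (intro allI impI)
  fix a b :: real assume "0 < a" "a \<le> b"
  with u v show "set_integrable lebesgue {a..b} (\<lambda>x. mul (u x) (V x) + mul (U x) (v x)) \<and>
      mul (U b) (V b) - mul (U a) (V a) = (LINT x:{a..b}|lebesgue. mul (u x) (V x) + mul (U x) (v x))"
    using integration_by_parts_lebesgue[OF assms(1), of a b u v U V]
    unfolding lebesgue_primitive_def by auto
qed

lemma lebesgue_primitive_eq_integral:
  assumes "lebesgue_primitive f G" "0 < a" "a \<le> t"
  shows "integral {a..t} f = G t - G a"
  using assms set_lebesgue_integral_eq_integral[of "{a..t}" f] unfolding lebesgue_primitive_def by auto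

text \<open>Countably many intervals \<open>{1 / Suc n<..<real (Suc n)}\<close> exhaust the
  half-line, and on each of them \<open>G\<close> is an indefinite integral plus its value at the
  left end.\<close>

lemma lebesgue_primitive_has_derivative_AE:
  assumes prim: "lebesgue_primitive f G"
  shows "AE x in lebesgue. 0 < x \<longrightarrow> (G has_vector_derivative f x) (at x)"
proof -
  define N where "N n = {x \<in> {1 / Suc n<..<real (Suc n)}.
      \<not> ((\<lambda>t. integral {1 / Suc n..t} f) has_vector_derivative f x) (at x)}" for n
  have int: "f integrable_on {1 / Suc n..real (Suc n)}" for n
  proof (rule set_lebesgue_integral_eq_integral(1))
    have "1 / real (Suc n) \<le> 1" "1 \<le> real (Suc n)" by simp_all
    then have "1 / real (Suc n) \<le> real (Suc n)" by linarith
    then show "set_integrable lebesgue {1 / Suc n..real (Suc n)} f"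
      using prim unfolding lebesgue_primitive_def by simp
  qed
  have "negligible (N n)" for n
    unfolding N_def by (rule negligible_not_has_vector_derivative_integral[OF int])
  then have "negligible (\<Union>n. N n)" by (intro negligible_countable_Union) auto
  then have "AE x in lebesgue. x \<notin> (\<Union>n. N n)"
    by (intro AE_not_in) (simp add: negligible_iff_null_sets)
  then show ?thesis
  proof (rule AE_mp, intro AE_I2 impI)
    fix x :: real assume x: "x \<notin> (\<Union>n. N n)" "0 < x"
    obtain n1 where n1: "1 / Suc n1 < x" using x nat_approx_posE by blast
    obtain n2 :: nat where n2: "x < n2" using reals_Archimedean2 by blast
    define n where "n = max n1 n2"
    have "1 / Suc n \<le> 1 / Suc n1" by (rule divide_left_mono) (auto simp: n_def)
    moreover have "real n2 \<le> real (Suc n)" by (auto simp: n_def)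
    ultimately have n: "x \<in> {1 / Suc n<..<real (Suc n)}" using n1 n2 by auto
    with x have "((\<lambda>t. integral {1 / Suc n..t} f) has_vector_derivative f x) (at x)"
      by (auto simp: N_def)
    then have "((\<lambda>t. integral {1 / Suc n..t} f + G (1 / Suc n)) has_vector_derivative f x) (at x)"
      by (auto intro!: derivative_eq_intros)
    then show "(G has_vector_derivative f x) (at x)"
    proof (rule has_vector_derivative_transform_within_open)
      show "x \<in> {1 / Suc n<..}" using n by auto
      show "integral {1 / Suc n..y} f + G (1 / Suc n) = G y" if "y \<in> {1 / Suc n<..}" for y
        using that by (subst lebesgue_primitive_eq_integral[OF prim]) auto
    qed simp
  qed
qed

lemma lebesgue_primitive_continuous_on:
  assumes prim: "lebesgue_primitive f G"
  shows "continuous_on {0<..} G"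
proof -
  have "isCont G x" if "0 < x" for x
  proof -
    have int: "f integrable_on {x / 2..x + 1}"
      using prim that unfolding lebesgue_primitive_def
      by (intro set_lebesgue_integral_eq_integral(1)) simp
    have "continuous_on {x / 2..x + 1} (\<lambda>t. integral {x / 2..t} f + G (x / 2))"
      by (intro continuous_intros indefinite_integral_continuous_1 int)
    then have "continuous_on {x / 2..x + 1} G"
      by (rule continuous_on_eq) (use that in \<open>auto simp: lebesgue_primitive_eq_integral[OF prim]\<close>)
    then have "continuous_on {x / 2<..<x + 1} G" by (rule continuous_on_subset) auto
    then show ?thesis using that by (simp add: continuous_on_eq_continuous_at)
  qed
  then show ?thesis by (simp add: continuous_at_imp_continuous_on)
qed

section \<open>Passing from compact intervals to the half-line\<close>

lemma LIMSEQ_indicator_exhaust: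
  fixes a b :: "nat \<Rightarrow> real"
  assumes "a \<longlonglongrightarrow> 0" "filterlim b at_top sequentially" "\<And>n. 0 < a n"
  shows "(\<lambda>n. indicat_real {a n..b n} x *\<^sub>R c) \<longlonglongrightarrow> indicat_real {0<..} x *\<^sub>R c"
proof (rule tendsto_eventually)
  show "\<forall>\<^sub>F n in sequentially. indicat_real {a n..b n} x *\<^sub>R c = indicat_real {0<..} x *\<^sub>R c"
  proof (cases "0 < x")
    case True
    then have "\<forall>\<^sub>F n in sequentially. a n < x" "\<forall>\<^sub>F n in sequentially. x \<le> b n"
      using assms(1,2) by (auto simp: order_tendsto_iff filterlim_at_top)
    then show ?thesis by eventually_elim (use True in auto)
  next
    case False
    then have "indicat_real {a n..b n} x = 0" for n using assms(3)[of n] by simp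
    moreover have "indicat_real {0<..} x = 0" using False by simp
    ultimately show ?thesis by (simp only: eventually_True simp_thms)
  qed
qed

lemma exhausting_sequences:
  "(\<lambda>n. 1 / real (Suc n)) \<longlonglongrightarrow> 0" "filterlim (\<lambda>n. real (Suc n)) at_top sequentially"
  by (rule LIMSEQ_Suc[OF lim_1_over_n], rule filterlim_compose[OF filterlim_real_sequentially filterlim_Suc])

lemma set_borel_measurable_exhaust:
  fixes f :: "real \<Rightarrow> 'a::euclidean_space"
  assumes "\<And>a b. 0 < a \<Longrightarrow> set_borel_measurable lebesgue {a..b} f"
  shows "set_borel_measurable lebesgue {0<..} f"
  unfolding set_borel_measurable_def
proof (rule borel_measurable_LIMSEQ_metric)
  show "(\<lambda>x. indicat_real {1 / Suc n..real (Suc n)} x *\<^sub>R f x) \<in> borel_measurable lebesgue" for n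
    using assms[of "1 / Suc n" "real (Suc n)"] by (simp add: set_borel_measurable_def)
  show "(\<lambda>n. indicat_real {1 / Suc n..real (Suc n)} x *\<^sub>R f x) \<longlonglongrightarrow> indicat_real {0<..} x *\<^sub>R f x" for x
    by (rule LIMSEQ_indicator_exhaust[OF exhausting_sequences]) simp
qed

lemma lebesgue_primitive_measurable:
  assumes "lebesgue_primitive f G"
  shows "set_borel_measurable lebesgue {0<..} f"
proof (rule set_borel_measurable_exhaust)
  fix a b :: real assume "0 < a"
  show "set_borel_measurable lebesgue {a..b} f"
  proof (cases "a \<le> b")
    case True
    with assms \<open>0 < a\<close> have "set_integrable lebesgue {a..b} f"
      by (simp add: lebesgue_primitive_def)
    then show ?thesis
      unfolding set_integrable_def set_borel_measurable_def by (rule borel_measurable_integrable)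
  qed (simp add: set_borel_measurable_def)
qed

text \<open>Dominated convergence with \<open>f\<close> on the half-line as majorant. The end points
  are arbitrary sequences, so that they can later be chosen where the boundary terms are
  small.\<close>

lemma tendsto_set_integral_exhaust:
  fixes f :: "real \<Rightarrow> 'a::euclidean_space"
  assumes f: "set_integrable lebesgue {0<..} f"
    and "a \<longlonglongrightarrow> 0" "filterlim b at_top sequentially" "\<And>n. 0 < a n"
  shows "(\<lambda>n. LINT x:{a n..b n}|lebesgue. f x) \<longlonglongrightarrow> (LINT x:{0<..}|lebesgue. f x)"
  unfolding set_lebesgue_integral_def
proof (rule integral_dominated_convergence)
  show "integrable lebesgue (\<lambda>x. norm (indicat_real {0<..} x *\<^sub>R f x))"
    using f by (simp only: set_integrable_def integrable_norm)
  show "(\<lambda>x. indicat_real {0<..} x *\<^sub>R f x) \<in> borel_measurable lebesgue"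
    using f by (auto simp: set_integrable_def)
  show "(\<lambda>x. indicat_real {a n..b n} x *\<^sub>R f x) \<in> borel_measurable lebesgue" for n
  proof -
    have "set_integrable lebesgue {a n..b n} f"
      using assms(4)[of n] by (intro set_integrable_subset[OF f]) auto
    then show ?thesis by (auto simp: set_integrable_def)
  qed
  show "AE x in lebesgue. (\<lambda>n. indicat_real {a n..b n} x *\<^sub>R f x) \<longlonglongrightarrow> indicat_real {0<..} x *\<^sub>R f x"
    by (intro AE_I2 LIMSEQ_indicator_exhaust assms)
  show "AE x in lebesgue. norm (indicat_real {a n..b n} x *\<^sub>R f x) \<le> norm (indicat_real {0<..} x *\<^sub>R f x)" for n
  proof (rule AE_I2)
    fix x show "norm (indicat_real {a n..b n} x *\<^sub>R f x) \<le> norm (indicat_real {0<..} x *\<^sub>R f x)"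
      using assms(4)[of n] by (auto simp: indicator_def)
  qed
qed

text \<open>Monotone convergence: by nonnegativity the integrals over the growing intervals
  increase, and the uniform bound \<open>M\<close> makes them converge.\<close>

lemma set_integrable_exhaust_bounded:
  fixes d :: "real \<Rightarrow> real"
  assumes int: "\<And>a b. \<lbrakk>0 < a; a \<le> b\<rbrakk> \<Longrightarrow> set_integrable lebesgue {a..b} d"
    and nonneg: "\<And>x. 0 < x \<Longrightarrow> 0 \<le> d x"
    and bound: "\<And>a b. \<lbrakk>0 < a; a \<le> b\<rbrakk> \<Longrightarrow> (LINT x:{a..b}|lebesgue. d x) \<le> M"
  shows "set_integrable lebesgue {0<..} d"
proof -
  define g where "g n x = indicat_real {1 / Suc n..real (Suc n)} x *\<^sub>R d x" for n x
  have le: "1 / real (Suc n) \<le> real (Suc n)" for n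
  proof -
    have "1 / real (Suc n) \<le> 1" "1 \<le> real (Suc n)" by simp_all
    then show ?thesis by linarith
  qed
  have int_g: "integrable lebesgue (g n)" for n
    using int[OF _ le, of n] by (simp add: g_def[abs_def] set_integrable_def)
  have mono_g: "g m x \<le> g n x" if "m \<le> n" for m n x
  proof -
    have "1 / real (Suc n) \<le> 1 / real (Suc m)" using that by (intro divide_left_mono) auto
    moreover have "real (Suc m) \<le> real (Suc n)" using that by simp
    ultimately have "{1 / Suc m..real (Suc m)} \<subseteq> {1 / Suc n..real (Suc n)}" by auto
    moreover have "0 < x" if "x \<in> {1 / Suc n..real (Suc n)}"
      
    proof -
      have "0 < 1 / real (Suc n)" by simp
      also have "\<dots> \<le> x" using that by simp
      finally show ?thesis .
    qed
    ultimately
    show ?thesis using nonneg[of x] by (auto simp: g_def indicator_def split: if_splits)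
  qed
  have "incseq (\<lambda>n. integral\<^sup>L lebesgue (g n))"
    unfolding incseq_def by (intro allI impI integral_mono int_g mono_g)
  moreover have "\<forall>n. integral\<^sup>L lebesgue (g n) \<le> M"
    using bound[OF _ le] by (simp add: g_def[abs_def] set_lebesgue_integral_def)
  ultimately obtain L where L: "(\<lambda>n. integral\<^sup>L lebesgue (g n)) \<longlonglongrightarrow> L"
    by (rule incseq_convergent)
  have lim: "(\<lambda>n. g n x) \<longlonglongrightarrow> indicat_real {0<..} x *\<^sub>R d x" for x
    unfolding g_def by (rule LIMSEQ_indicator_exhaust[OF exhausting_sequences]) simp
  show ?thesis
    unfolding set_integrable_def
  proof (rule integrable_monotone_convergence[OF int_g _ _ L])
    show "AE x in lebesgue. mono (\<lambda>n. g n x)" using mono_g by (auto simp: mono_def)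
    show "AE x in lebesgue. (\<lambda>n. g n x) \<longlonglongrightarrow> indicat_real {0<..} x *\<^sub>R d x" using lim by simp
    show "(\<lambda>x. indicat_real {0<..} x *\<^sub>R d x) \<in> borel_measurable lebesgue"
      by (rule borel_measurable_LIMSEQ_metric[OF borel_measurable_integrable[OF int_g] lim])
  qed
qed

section \<open>Divergence of the integral of 1/x\<close>

lemma set_integral_inverse:
  assumes "0 < a" "a \<le> b"
  shows "set_integrable lebesgue {a..b} (\<lambda>x::real. 1 / x)" and "(LINT x:{a..b}|lebesgue. 1 / x) = ln b - ln a"
proof -
  have "lebesgue_primitive (\<lambda>x. 1 / x) ln"
    by (rule lebesgue_primitive_smooth)
      (auto intro!: derivative_eq_intros continuous_intros
        simp: has_real_derivative_iff_has_vector_derivative[symmetric])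
  with assms show "set_integrable lebesgue {a..b} (\<lambda>x::real. 1 / x)" "(LINT x:{a..b}|lebesgue. 1 / x) = ln b - ln a"
    by (simp_all add: lebesgue_primitive_def)
qed

text \<open>A finite integral over \<open>S\<close> would bound \<open>ln b - ln a\<close> for all
  intervals inside \<open>S\<close>.\<close>

lemma not_set_integrable_inverse:
  fixes S :: "real set"
  assumes S: "S \<subseteq> {0<..}" and sub: "\<And>M. \<exists>a b. 0 < a \<and> a \<le> b \<and> {a..b} \<subseteq> S \<and> M < ln b - ln a"
  shows "\<not> set_integrable lebesgue S (\<lambda>x. 1 / x)"
proof
  assume int: "set_integrable lebesgue S (\<lambda>x. 1 / x)"
  obtain a b where ab: "0 < a" "a \<le> b" "{a..b} \<subseteq> S" "(LINT x:S|lebesgue. 1 / x) < ln b - ln a"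
    using sub by blast
  have "(LINT x:{a..b}|lebesgue. 1 / x) \<le> (LINT x:S|lebesgue. 1 / x)"
    unfolding set_lebesgue_integral_def
    using int set_integral_inverse(1)[OF ab(1,2)] ab(3) S
    by (intro integral_mono) (auto simp: set_integrable_def indicator_def)
  with ab set_integral_inverse(2)[OF ab(1,2)] show False by simp
qed

lemma not_set_integrable_inverse_at_0:
  assumes "0 < (d::real)"
  shows "\<not> set_integrable lebesgue {0<..d} (\<lambda>x. 1 / x)"
proof (rule not_set_integrable_inverse)
  fix M :: real
  \<comment> \<open>This left end gives logarithmic length \<open>\<bar>M\<bar> + 1\<close>, which
    exceeds \<open>M\<close>, and it stays below \<open>d\<close> whatever the sign of
    \<open>M\<close>.\<close>
  have "d * exp (- \<bar>M\<bar> - 1) \<le> d * 1" using assms by (intro mult_left_mono) auto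
  moreover have "ln d - ln (d * exp (- \<bar>M\<bar> - 1)) > M" using assms by (simp add: ln_mult)
  moreover have "0 < d * exp (- \<bar>M\<bar> - 1)" using assms by simp
  ultimately show "\<exists>a b. 0 < a \<and> a \<le> b \<and> {a..b} \<subseteq> {0<..d} \<and> M < ln b - ln a"
    by (intro exI[of _ "d * exp (- \<bar>M\<bar> - 1)"] exI[of _ d]) (simp add: subset_iff)
qed auto

lemma not_set_integrable_inverse_at_top:
  assumes "0 < (d::real)"
  shows "\<not> set_integrable lebesgue {d..} (\<lambda>x. 1 / x)"
proof (rule not_set_integrable_inverse)
  fix M :: real
  have "d * 1 \<le> d * exp (\<bar>M\<bar> + 1)" using assms by (intro mult_left_mono) auto
  moreover have "ln (d * exp (\<bar>M\<bar> + 1)) - ln d > M" using assms by (simp add: ln_mult)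
  ultimately show "\<exists>a b. 0 < a \<and> a \<le> b \<and> {a..b} \<subseteq> {d..} \<and> M < ln b - ln a"
    using assms by (intro exI[of _ d] exI[of _ "d * exp (\<bar>M\<bar> + 1)"]) auto
qed (use assms in auto)

text \<open>If \<open>h\<close> were at least \<open>e\<close> throughout \<open>S\<close>, then
  \<open>1 / x\<close> would be dominated by \<open>(1 / e) * (h x / x)\<close> and be integrable
  there. With \<open>S\<close> close to 0 or to infinity this supplies points where a boundary term
  is small.\<close>

lemma set_integrable_over_self_small:
  fixes h :: "real \<Rightarrow> real"
  assumes int: "set_integrable lebesgue {0<..} (\<lambda>x. h x / x)" and "0 < e"
    and S: "S \<subseteq> {0<..}" "S \<in> sets borel" "\<not> set_integrable lebesgue S (\<lambda>x. 1 / x)"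
  shows "\<exists>x\<in>S. h x < e"
proof (rule ccontr)
  assume "\<not> (\<exists>x\<in>S. h x < e)"
  then have ge: "e \<le> h x" if "x \<in> S" for x using that by force
  have "set_integrable lebesgue S (\<lambda>x. 1 / x)"
  proof (rule set_integrable_bound)
    show "set_integrable lebesgue S (\<lambda>x. (1 / e) * (h x / x))"
      using int S by (intro set_integrable_mult_right set_integrable_subset[OF int]) auto
    show "set_borel_measurable lebesgue S (\<lambda>x. 1 / x)"
      unfolding set_borel_measurable_def using S by (intro measurable_completion) simp
    show "AE x in lebesgue. x \<in> S \<longrightarrow> norm (1 / x) \<le> norm (1 / e * (h x / x))"
    proof (intro AE_I2 impI)
      fix x assume "x \<in> S"
      then have x: "0 < x" "e \<le> h x" using S ge by auto
      with \<open>0 < e\<close> show "norm (1 / x) \<le> norm (1 / e * (h x / x))" by (simp add: divide_simps)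
    qed
  qed
  with S(3) show False by contradiction
qed

lemma lebesgue_primitive_scaleR:
  assumes "lebesgue_primitive f G"
  shows "lebesgue_primitive (\<lambda>x. c *\<^sub>R f x) (\<lambda>x. c *\<^sub>R G x)"
  using assms unfolding lebesgue_primitive_def
  by (auto simp: scaleR_right_diff_distrib[symmetric])

section \<open>A weighted bound for integrals of f\<close>

text \<open>A pointwise AM-GM inequality replaces Cauchy-Schwarz and gives integrability along with
  the bound; \<open>s\<close> is free so that the two terms can be balanced later.
  \<open>\<alpha>\<close> will be \<open>p\<close> for integrals from 0 and \<open>- p\<close> for
  integrals to infinity. \<open>T\<close> may exceed \<open>S\<close>, so that power integrals over
  closed intervals apply.\<close>

lemma weighted_integrable:
  fixes f :: "real \<Rightarrow> complex" and \<alpha> s I :: real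
  assumes f: "set_borel_measurable lebesgue {0<..} f"
    and W: "set_integrable lebesgue {0<..} (\<lambda>y. y powr (- \<alpha> + 1) * (cmod (f y))\<^sup>2)"
    and S: "S \<subseteq> {0<..}" "S \<in> sets lebesgue" "S \<subseteq> T"
    and w: "set_integrable lebesgue T (\<lambda>y. y powr (\<alpha> - 1))" "(LINT y:T|lebesgue. y powr (\<alpha> - 1)) \<le> I"
    and s: "0 < s"
  shows "set_integrable lebesgue S f"
    and "cmod (LINT y:S|lebesgue. f y) \<le> (s * (LINT y:{0<..}|lebesgue. y powr (- \<alpha> + 1) * (cmod (f y))\<^sup>2) + I / s) / 2"
proof -
  define g where "g y = (s * (indicat_real {0<..} y *\<^sub>R (y powr (- \<alpha> + 1) * (cmod (f y))\<^sup>2))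
      + (indicat_real T y *\<^sub>R y powr (\<alpha> - 1)) / s) / 2" for y
  have g: "integrable lebesgue g"
    using W w(1) unfolding g_def set_integrable_def by auto
  have le: "norm (indicat_real S y *\<^sub>R f y) \<le> g y" for y
  proof (cases "y \<in> S")
    case True
    \<comment> \<open>AM-GM: \<open>2 |f| \<le> q |f|\<^sup>2 + 1 / q\<close>.\<close>
    define q where "q = s * y powr (- \<alpha> + 1)"
    have y: "0 < y" "y \<in> T" using True S by auto
    then have "q > 0" using s by (simp add: q_def)
    have "0 \<le> (q * cmod (f y) - 1)\<^sup>2" by simp
    then have "2 * (q * cmod (f y)) \<le> q\<^sup>2 * (cmod (f y))\<^sup>2 + 1"
      by (simp add: power2_diff power_mult_distrib)
    then have "2 * cmod (f y) \<le> q * (cmod (f y))\<^sup>2 + 1 / q"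
      using \<open>q > 0\<close> by (simp add: field_simps power2_eq_square)
    moreover have "1 / q = y powr (\<alpha> - 1) / s"
      using y s by (simp add: q_def field_simps powr_add[symmetric])
    ultimately show ?thesis using True y by (simp add: g_def q_def mult.assoc)
  next
    case False
    then show ?thesis using s by (simp add: g_def)
  qed
  have "set_borel_measurable lebesgue S f"
    by (rule set_borel_measurable_subset[OF f S(2,1)])
  with g have int: "integrable lebesgue (\<lambda>y. indicat_real S y *\<^sub>R f y)"
    unfolding set_borel_measurable_def
    by (rule Bochner_Integration.integrable_bound)
      (unfold real_norm_def, intro AE_I2 order_trans[OF le abs_ge_self])
  then show "set_integrable lebesgue S f" by (simp only: set_integrable_def)
  have "cmod (LINT y:S|lebesgue. f y) \<le> (\<integral>y. norm (indicat_real S y *\<^sub>R f y) \<partial>lebesgue)"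
    unfolding set_lebesgue_integral_def by (rule integral_norm_bound)
  also have "\<dots> \<le> integral\<^sup>L lebesgue g"
    using int g le by (intro integral_mono integrable_norm) auto
  also have "\<dots> = (s * (LINT y:{0<..}|lebesgue. y powr (- \<alpha> + 1) * (cmod (f y))\<^sup>2)
      + (LINT y:T|lebesgue. y powr (\<alpha> - 1)) / s) / 2"
    using W w(1) unfolding g_def set_integrable_def set_lebesgue_integral_def by simp
  also have "\<dots> \<le> (s * (LINT y:{0<..}|lebesgue. y powr (- \<alpha> + 1) * (cmod (f y))\<^sup>2) + I / s) / 2"
    using w(2) s by (simp add: divide_right_mono)
  finally show "cmod (LINT y:S|lebesgue. f y)
      \<le> (s * (LINT y:{0<..}|lebesgue. y powr (- \<alpha> + 1) * (cmod (f y))\<^sup>2) + I / s) / 2" .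
qed

subsection \<open>The weighted identity\<close>

text \<open>The sign \<sigma> lets one argument serve both parts. Only increments of
  \<open>F\<close> enter here; the growth bound that controls the boundary terms is supplied
  separately.\<close>

locale hardy_pair =
  fixes p \<sigma> :: real and f F :: "real \<Rightarrow> complex"
  assumes p: "0 < p" and \<sigma>: "\<sigma> = 1 \<or> \<sigma> = -1"
    and prim: "lebesgue_primitive f (\<lambda>x. \<sigma> *\<^sub>R F x)"
begin

definition H where "H x = x powr (- (\<sigma> * p) / 2) *\<^sub>R F x"
definition k where "k x = x powr (- (\<sigma> * p) / 2) *\<^sub>R (f x - (p / (2 * x)) *\<^sub>R F x)"

lemma \<sigma>_square: "\<sigma> * \<sigma> = 1"
  using \<sigma> by auto

text \<open>Product rule for the power and \<open>F\<close>: with exponent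
  \<open>e = - (\<sigma> * p) / 2\<close> the derivative of the power produces exactly the term with
  \<open>p / (2 * x)\<close> in \<open>k\<close>, up to the factor \<sigma>.\<close>

lemma prim_H: "lebesgue_primitive (\<lambda>x. \<sigma> *\<^sub>R k x) H"
proof -
  have F: "lebesgue_primitive (\<lambda>x. \<sigma> *\<^sub>R f x) F"
    using lebesgue_primitive_scaleR[OF prim, of \<sigma>] by (simp add: \<sigma>_square)
  define e where "e = - (\<sigma> * p) / 2"
  have "lebesgue_primitive (\<lambda>x. e * x powr (e - 1)) (\<lambda>x. x powr e)"
    by (rule lebesgue_primitive_smooth)
      (auto intro!: derivative_eq_intros continuous_intros
        simp: has_real_derivative_iff_has_vector_derivative[symmetric])
  from lebesgue_primitive_bilinear[OF bounded_bilinear_scaleR this F]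
  show ?thesis
  proof (rule lebesgue_primitive_cong)
    fix x :: real assume "0 < x"
    then have "e * x powr (e - 1) = - \<sigma> * x powr e * (p / (2 * x))"
      by (simp add: powr_diff e_def)
    then show "(e * x powr (e - 1)) *\<^sub>R F x + x powr e *\<^sub>R \<sigma> *\<^sub>R f x = \<sigma> *\<^sub>R k x"
      unfolding k_def e_def[symmetric] by (simp add: algebra_simps)
    show "x powr e *\<^sub>R F x = H x" by (simp add: H_def e_def)
  qed
qed

lemma has_derivative_H: "AE x in lebesgue. 0 < x \<longrightarrow> (H has_vector_derivative \<sigma> *\<^sub>R k x) (at x)"
  by (rule lebesgue_primitive_has_derivative_AE[OF prim_H])

text \<open>\<open>\<sigma> *\<^sub>R k x\<close> is measurable as the density of \<open>H\<close>,
  and a second factor \<sigma> recovers \<open>k\<close>.\<close>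

lemma k_measurable: "set_borel_measurable lebesgue {0<..} k"
proof -
  have "k = (\<lambda>x. \<sigma> *\<^sub>R (\<sigma> *\<^sub>R k x))" by (simp add: \<sigma>_square)
  moreover have "set_borel_measurable lebesgue {0<..} (\<lambda>x. \<sigma> *\<^sub>R (\<sigma> *\<^sub>R k x))"
    by (rule lebesgue_primitive_measurable[OF lebesgue_primitive_scaleR[OF prim_H]])
  ultimately show ?thesis by simp
qed

lemma powr_weight:
  assumes "0 < x"
  shows "x powr (- (\<sigma> * p) + 1) = x * (x powr (- (\<sigma> * p) / 2))\<^sup>2"
proof -
  have "x powr (- (\<sigma> * p) + 1) = x powr (- (\<sigma> * p) / 2 + - (\<sigma> * p) / 2 + 1)" by simp
  also have "\<dots> = x powr (- (\<sigma> * p) / 2) * x powr (- (\<sigma> * p) / 2) * x"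
    using assms by (simp only: powr_add powr_one)
  finally show ?thesis by (simp add: power2_eq_square)
qed

lemma remainder_eq:
  assumes "0 < x"
  shows "x powr (- (\<sigma> * p) + 1) * (cmod (f x - (p / (2 * x)) *\<^sub>R F x))\<^sup>2 = x * (cmod (k x))\<^sup>2"
  using powr_weight[OF assms] by (simp add: k_def power_mult_distrib)

lemma average_eq:
  assumes "0 < x"
  shows "x powr (- (\<sigma> * p) + 1) * (cmod ((1 / x) *\<^sub>R F x))\<^sup>2 = (cmod (H x))\<^sup>2 / x"
  using powr_weight[OF assms] assms
  by (simp add: H_def power_mult_distrib power_divide) (simp add: power2_eq_square)

lemma weighted_square_expand:
  assumes "0 < x"
  shows "x powr (- (\<sigma> * p) + 1) * (cmod (f x))\<^sup>2
    = x * (cmod (k x))\<^sup>2 + p * (H x \<bullet> k x) + (p / 2)\<^sup>2 * ((cmod (H x))\<^sup>2 / x)"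
proof -
  define e where "e = x powr (- (\<sigma> * p) / 2)"
  have "e *\<^sub>R f x = k x + (p / (2 * x)) *\<^sub>R H x"
    by (simp add: k_def H_def e_def algebra_simps)
  then have "e\<^sup>2 * (cmod (f x))\<^sup>2 = (norm (k x + (p / (2 * x)) *\<^sub>R H x))\<^sup>2"
    by (metis norm_scaleR power2_abs power_mult_distrib)
  also have "\<dots> = (cmod (k x))\<^sup>2 + (p / x) * (H x \<bullet> k x) + (p / (2 * x))\<^sup>2 * (cmod (H x))\<^sup>2"
    unfolding power2_norm_eq_inner
    by (simp add: inner_add_left inner_add_right inner_commute[of "k x" "H x"] power2_eq_square algebra_simps)
  finally have "x * (e\<^sup>2 * (cmod (f x))\<^sup>2)
      = x * ((cmod (k x))\<^sup>2 + (p / x) * (H x \<bullet> k x) + (p / (2 * x))\<^sup>2 * (cmod (H x))\<^sup>2)" by simp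
  also have "\<dots> = x * (cmod (k x))\<^sup>2 + p * (H x \<bullet> k x) + (p / 2)\<^sup>2 * ((cmod (H x))\<^sup>2 / x)"
    using assms by (simp add: algebra_simps power2_eq_square)
  finally show ?thesis
    unfolding powr_weight[OF assms] e_def by (simp add: mult.assoc)
qed

text \<open>Identifies the cross term of the expanded square: since \<sigma> squares to 1,
  \<open>p * (H x \<bullet> k x)\<close> is \<open>\<sigma> * p / 2\<close> times this density and
  integrates to boundary values.\<close>

lemma prim_square: "lebesgue_primitive (\<lambda>x. 2 * \<sigma> * (H x \<bullet> k x)) (\<lambda>x. (cmod (H x))\<^sup>2)"
  by (rule lebesgue_primitive_cong[OF lebesgue_primitive_bilinear[OF bounded_bilinear_inner prim_H prim_H]])
    (simp_all add: inner_commute power2_norm_eq_inner)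

lemma continuous_H: "continuous_on {0<..} H"
  by (rule lebesgue_primitive_continuous_on[OF prim_H])

lemma
  assumes W: "set_integrable lebesgue {0<..} (\<lambda>x. x powr (- (\<sigma> * p) + 1) * (cmod (f x))\<^sup>2)"
    and K: "\<And>x. 0 < x \<Longrightarrow> cmod (H x) \<le> K"
  shows integrable_average: "set_integrable lebesgue {0<..} (\<lambda>x. (cmod (H x))\<^sup>2 / x)"
    and integrable_remainder: "set_integrable lebesgue {0<..} (\<lambda>x. x * (cmod (k x))\<^sup>2)"
    and hardy_identity: "(p / 2)\<^sup>2 * (LINT x:{0<..}|lebesgue. (cmod (H x))\<^sup>2 / x)
      = (LINT x:{0<..}|lebesgue. x powr (- (\<sigma> * p) + 1) * (cmod (f x))\<^sup>2)
        - (LINT x:{0<..}|lebesgue. x * (cmod (k x))\<^sup>2)"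
proof -
  define w where "w x = x powr (- (\<sigma> * p) + 1) * (cmod (f x))\<^sup>2" for x
  define h where "h x = (cmod (H x))\<^sup>2" for x
  define h' where "h' x = 2 * \<sigma> * (H x \<bullet> k x)" for x
  \<comment> \<open>The two nonnegative terms are kept together: their sum is \<open>w\<close> minus
    an exact derivative, so it is the sum whose integrability comes first.\<close>
  define d where "d x = x * (cmod (k x))\<^sup>2 + (p / 2)\<^sup>2 * (h x / x)" for x
  have w: "set_integrable lebesgue {0<..} w" using W by (simp add: w_def[abs_def])
  have prim_h: "lebesgue_primitive h' h"
    using prim_square by (simp add: h_def[abs_def] h'_def[abs_def])
  have w_eq: "d x = w x - (\<sigma> * p / 2) * h' x" if "0 < x" for x
  proof -
    have "(\<sigma> * p / 2) * h' x = (\<sigma> * \<sigma>) * (p * (H x \<bullet> k x))" by (simp add: h'_def)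
    also have "\<dots> = p * (H x \<bullet> k x)" by (simp only: \<sigma>_square mult_1)
    finally show ?thesis
      using weighted_square_expand[OF that] unfolding d_def w_def h_def by linarith
  qed
  have h_nonneg: "0 \<le> h x" for x by (simp add: h_def)
  have h_bound: "h x \<le> K\<^sup>2" if "0 < x" for x
    using power_mono[OF K[OF that], of 2] by (simp add: h_def)
  have w_nonneg: "0 \<le> w x" for x by (simp add: w_def)
  have piece: "set_integrable lebesgue {a..b} d \<and>
      (LINT x:{a..b}|lebesgue. d x) = (LINT x:{a..b}|lebesgue. w x) - (\<sigma> * p / 2) * (h b - h a)"
    if ab: "0 < a" "a \<le> b" for a b
  proof -
    have wab: "set_integrable lebesgue {a..b} w"
      by (rule set_integrable_subset[OF w]) (use ab in auto)
    have hab: "set_integrable lebesgue {a..b} h'" "h b - h a = (LINT x:{a..b}|lebesgue. h' x)"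
      using prim_h ab by (auto simp: lebesgue_primitive_def)
    have "set_integrable lebesgue {a..b} d = set_integrable lebesgue {a..b} (\<lambda>x. w x - (\<sigma> * p / 2) * h' x)"
      using ab by (intro set_integrable_cong) (auto simp: w_eq)
    moreover have "set_integrable lebesgue {a..b} (\<lambda>x. w x - (\<sigma> * p / 2) * h' x)"
      by (intro set_integral_diff(1) set_integrable_mult_right wab hab(1))
    moreover have "(LINT x:{a..b}|lebesgue. d x) = (LINT x:{a..b}|lebesgue. w x - (\<sigma> * p / 2) * h' x)"
      using ab by (intro set_lebesgue_integral_cong) (auto simp: w_eq)
    moreover have "\<dots> = (LINT x:{a..b}|lebesgue. w x) - (LINT x:{a..b}|lebesgue. (\<sigma> * p / 2) * h' x)"
      by (intro set_integral_diff(2) set_integrable_mult_right wab hab(1))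
    ultimately show ?thesis by (simp only: hab(2) set_integral_mult_right simp_thms)
  qed
  have d_nonneg: "0 \<le> d x" if "0 < x" for x
    using that h_nonneg[of x] by (simp add: d_def)
  have d: "set_integrable lebesgue {0<..} d"
  proof (rule set_integrable_exhaust_bounded)
    fix a b :: real assume ab: "0 < a" "a \<le> b"
    show "set_integrable lebesgue {a..b} d" using piece[OF ab] by blast
    have "(LINT x:{a..b}|lebesgue. w x) \<le> (LINT x:{0<..}|lebesgue. w x)"
      unfolding set_lebesgue_integral_def
    proof (rule integral_mono)
      show "integrable lebesgue (\<lambda>x. indicat_real {a..b} x *\<^sub>R w x)"
        unfolding set_integrable_def[symmetric] by (rule set_integrable_subset[OF w]) (use ab in auto)
      show "integrable lebesgue (\<lambda>x. indicat_real {0<..} x *\<^sub>R w x)"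
        using w by (simp only: set_integrable_def)
      show "indicat_real {a..b} x *\<^sub>R w x \<le> indicat_real {0<..} x *\<^sub>R w x" for x
        using ab w_nonneg[of x] by (auto simp: indicator_def)
    qed
    \<comment> \<open>Both boundary values of \<open>h\<close> lie between 0 and
      \<open>K\<^sup>2\<close>, so their difference is at most \<open>K\<^sup>2\<close> for either
      sign \<sigma>.\<close>
    moreover have "- (\<sigma> * p / 2) * (h b - h a) \<le> p / 2 * K\<^sup>2"
    proof -
      have "- \<sigma> * (h b - h a) \<le> K\<^sup>2"
        using \<sigma> h_bound[of a] h_bound[of b] h_nonneg[of a] h_nonneg[of b] ab by auto
      then have "(p / 2) * (- \<sigma> * (h b - h a)) \<le> (p / 2) * K\<^sup>2"
        using p by (intro mult_left_mono) auto
      then show ?thesis by (simp add: mult_ac)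
    qed
    ultimately show "(LINT x:{a..b}|lebesgue. d x) \<le> (LINT x:{0<..}|lebesgue. w x) + p / 2 * K\<^sup>2"
      using piece[OF ab] by linarith
  qed (rule d_nonneg)
  have h_cont: "continuous_on {0<..} (\<lambda>x. h x / x)"
    unfolding h_def by (intro continuous_intros continuous_H) auto
  show avg: "set_integrable lebesgue {0<..} (\<lambda>x. (cmod (H x))\<^sup>2 / x)"
  proof (rule set_integrable_bound)
    \<comment> \<open>The factor inverts \<open>(p / 2)\<^sup>2\<close>, because the average term
      alone is dominated by \<open>d\<close>.\<close>
    show "set_integrable lebesgue {0<..} (\<lambda>x. (4 / p\<^sup>2) * d x)"
      by (intro set_integrable_mult_right d)
    show "set_borel_measurable lebesgue {0<..} (\<lambda>x. (cmod (H x))\<^sup>2 / x)"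
      using set_measurable_continuous_on[OF _ h_cont]
      unfolding set_borel_measurable_def h_def by (intro measurable_completion) simp
    show "AE x in lebesgue. x \<in> {0<..} \<longrightarrow> norm ((cmod (H x))\<^sup>2 / x) \<le> norm ((4 / p\<^sup>2) * d x)"
    proof (intro AE_I2 impI)
      fix x :: real assume "x \<in> {0<..}"
      then have x: "0 < x" by simp
      have "(p / 2)\<^sup>2 * (h x / x) \<le> d x" using x by (simp add: d_def)
      then have "(4 / p\<^sup>2) * ((p / 2)\<^sup>2 * (h x / x)) \<le> (4 / p\<^sup>2) * d x"
        by (intro mult_left_mono) auto
      moreover have "(4 / p\<^sup>2) * ((p / 2)\<^sup>2 * (h x / x)) = h x / x"
        using p by (simp add: power2_eq_square)
      moreover have "0 \<le> h x / x" using x h_nonneg by simp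
      ultimately show "norm ((cmod (H x))\<^sup>2 / x) \<le> norm ((4 / p\<^sup>2) * d x)"
        unfolding h_def real_norm_def by linarith
    qed
  qed
  then have avg_h: "set_integrable lebesgue {0<..} (\<lambda>x. h x / x)" by (simp add: h_def)
  have rem_eq: "(\<lambda>x. x * (cmod (k x))\<^sup>2) = (\<lambda>x. d x - (p / 2)\<^sup>2 * (h x / x))"
    by (simp add: d_def fun_eq_iff)
  show rem: "set_integrable lebesgue {0<..} (\<lambda>x. x * (cmod (k x))\<^sup>2)"
    unfolding rem_eq by (intro set_integral_diff(1) set_integrable_mult_right d avg_h)
  \<comment> \<open>The search runs over \<open>{real (Suc n)..}\<close>, so that the point found is
    positive also for \<open>n = 0\<close>.\<close>
  have ex_b: "\<exists>x. real n \<le> x \<and> 0 < x \<and> h x < 1 / Suc n" for n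
  proof -
    have "\<exists>x\<in>{real (Suc n)..}. h x < 1 / Suc n"
      by (rule set_integrable_over_self_small[OF avg_h _ _ _ not_set_integrable_inverse_at_top]) auto
    then obtain x where "real (Suc n) \<le> x" "h x < 1 / Suc n" by (meson atLeast_iff)
    then show ?thesis by (intro exI[of _ x] conjI) auto
  qed
  have ex_a: "\<exists>x. 0 < x \<and> x \<le> 1 / Suc n \<and> h x < 1 / Suc n" for n
  proof -
    have "\<exists>x\<in>{0<..1 / real (Suc n)}. h x < 1 / Suc n"
      by (rule set_integrable_over_self_small[OF avg_h _ _ _ not_set_integrable_inverse_at_0]) auto
    then show ?thesis by (meson greaterThanAtMost_iff)
  qed
  obtain a where a: "\<And>n. 0 < a n" "\<And>n. a n \<le> 1 / Suc n" "\<And>n. h (a n) < 1 / Suc n"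
    using ex_a by metis
  obtain b where b: "\<And>n. real n \<le> b n" "\<And>n. 0 < b n" "\<And>n. h (b n) < 1 / Suc n"
    using ex_b by metis
  have "a \<longlonglongrightarrow> 0"
    by (rule tendsto_sandwich[OF _ _ tendsto_const exhausting_sequences(1)])
      (use a in \<open>auto intro!: always_eventually less_imp_le\<close>)
  moreover have "filterlim b at_top sequentially"
    by (rule filterlim_at_top_mono[OF filterlim_real_sequentially]) (use b in auto)
  \<comment> \<open>For \<open>n = 0\<close> the choices permit \<open>b 0 < a 0\<close>; from
    \<open>n = 1\<close> on, 1 separates the two sequences.\<close>
  moreover have "\<forall>\<^sub>F n in sequentially. a n \<le> b n"
  proof -
    have "a n \<le> b n" if "1 \<le> n" for n
    proof -
      have "1 / real (Suc n) \<le> 1" by simp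
      with a(2)[of n] b(1)[of n] that show ?thesis by (smt (verit) of_nat_1 of_nat_le_iff)
    qed
    then show ?thesis by (auto simp: eventually_sequentially)
  qed
  ultimately have lims: "(\<lambda>n. LINT x:{a n..b n}|lebesgue. d x) \<longlonglongrightarrow> (LINT x:{0<..}|lebesgue. d x)"
      "(\<lambda>n. LINT x:{a n..b n}|lebesgue. w x) \<longlonglongrightarrow> (LINT x:{0<..}|lebesgue. w x)"
    and ev: "\<forall>\<^sub>F n in sequentially. a n \<le> b n"
    using tendsto_set_integral_exhaust[OF d] tendsto_set_integral_exhaust[OF w] a(1) by blast+
  have "(\<lambda>n. h (a n)) \<longlonglongrightarrow> 0"
    by (rule tendsto_sandwich[OF _ _ tendsto_const exhausting_sequences(1)])
      (use a h_nonneg in \<open>auto intro!: always_eventually less_imp_le\<close>)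
  moreover have "(\<lambda>n. h (b n)) \<longlonglongrightarrow> 0"
    by (rule tendsto_sandwich[OF _ _ tendsto_const exhausting_sequences(1)])
      (use b h_nonneg in \<open>auto intro!: always_eventually less_imp_le\<close>)
  ultimately have "(\<lambda>n. (LINT x:{a n..b n}|lebesgue. w x) - (\<sigma> * p / 2) * (h (b n) - h (a n)))
      \<longlonglongrightarrow> (LINT x:{0<..}|lebesgue. w x) - (\<sigma> * p / 2) * (0 - 0)"
    by (intro tendsto_intros lims)
  then have "(\<lambda>n. LINT x:{a n..b n}|lebesgue. d x) \<longlonglongrightarrow> (LINT x:{0<..}|lebesgue. w x) - (\<sigma> * p / 2) * (0 - 0)"
    by (rule Lim_transform_eventually) (use ev piece a(1) in \<open>auto elim!: eventually_mono\<close>)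
  from LIMSEQ_unique[OF lims(1) this]
  have "(LINT x:{0<..}|lebesgue. d x) = (LINT x:{0<..}|lebesgue. w x)" by simp
  moreover have "(LINT x:{0<..}|lebesgue. d x)
      = (LINT x:{0<..}|lebesgue. x * (cmod (k x))\<^sup>2) + (p / 2)\<^sup>2 * (LINT x:{0<..}|lebesgue. h x / x)"
  proof -
    have "set_integrable lebesgue {0<..} (\<lambda>x. (p / 2)\<^sup>2 * (h x / x))"
      by (intro set_integrable_mult_right avg_h)
    from set_integral_add(2)[OF rem this] show ?thesis
      unfolding d_def by (simp only: set_integral_mult_right)
  qed
  ultimately show "(p / 2)\<^sup>2 * (LINT x:{0<..}|lebesgue. (cmod (H x))\<^sup>2 / x)
      = (LINT x:{0<..}|lebesgue. x powr (- (\<sigma> * p) + 1) * (cmod (f x))\<^sup>2)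
        - (LINT x:{0<..}|lebesgue. x * (cmod (k x))\<^sup>2)"
    by (simp add: h_def w_def)
qed

section \<open>The equality case and the extremal functions\<close>

text \<open>Both sides say that \<open>H\<close> is constant on the half-line. Increments of
  \<open>H\<close> are integrals of \<open>\<sigma> *\<^sub>R k x\<close>, so an almost everywhere
  zero \<open>k\<close> fixes \<open>H\<close> at every point; conversely the derivative of a
  constant \<open>H\<close> is 0 and almost everywhere
  \<open>\<sigma> *\<^sub>R k x\<close>.\<close>

lemma remainder_AE_zero_iff:
  "(AE x in lebesgue. 0 < x \<longrightarrow> k x = 0) \<longleftrightarrow> (\<exists>c. \<forall>x>0. F x = c * of_real (x powr (\<sigma> * p / 2)))"
proof
  assume zero: "AE x in lebesgue. 0 < x \<longrightarrow> k x = 0"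
  have const: "H b = H a" if ab: "0 < a" "a \<le> b" for a b
  proof -
    have "H b - H a = (\<integral>x. indicat_real {a..b} x *\<^sub>R \<sigma> *\<^sub>R k x \<partial>lebesgue)"
      using prim_H ab unfolding lebesgue_primitive_def set_lebesgue_integral_def by blast
    also have "\<dots> = 0"
      using zero ab by (intro integral_eq_zero_AE) (auto elim!: eventually_mono simp: indicator_def)
    finally show ?thesis by simp
  qed
  \<comment> \<open>The witness is the constant value of \<open>H\<close>, read off at 1.\<close>
  have "F x = H 1 * of_real (x powr (\<sigma> * p / 2))" if "0 < x" for x
  proof -
    have "H x = H 1"
    proof (cases "x \<le> 1")
      case True
      show ?thesis by (rule const[OF that True, symmetric])
    next
      case False
      then show ?thesis by (intro const) auto
    qed
    moreover have "x powr (\<sigma> * p / 2) *\<^sub>R H x = F x"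
      using that by (simp add: H_def powr_add[symmetric])
    ultimately show ?thesis by (metis mult.commute scaleR_conv_of_real)
  qed
  then show "\<exists>c. \<forall>x>0. F x = c * of_real (x powr (\<sigma> * p / 2))" by blast
next
  assume "\<exists>c. \<forall>x>0. F x = c * of_real (x powr (\<sigma> * p / 2))"
  then obtain c where c: "\<And>x. 0 < x \<Longrightarrow> F x = c * of_real (x powr (\<sigma> * p / 2))" by blast
  have H: "H x = c" if "0 < x" for x
    using that c by (simp add: H_def scaleR_conv_of_real flip: of_real_mult powr_add)
  show "AE x in lebesgue. 0 < x \<longrightarrow> k x = 0"
    using has_derivative_H
  proof (rule AE_mp, intro AE_I2 impI)
    fix x assume x: "0 < x \<longrightarrow> (H has_vector_derivative \<sigma> *\<^sub>R k x) (at x)" "0 < x"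
    have "(H has_vector_derivative 0) (at x)"
      by (rule has_vector_derivative_transform_within_open[OF has_vector_derivative_const, of "{0<..}"])
        (use x H in auto)
    with x have "\<sigma> *\<^sub>R k x = 0" by (metis vector_derivative_at)
    then show "k x = 0" using \<sigma> by auto
  qed
qed

text \<open>The nonnegative integral is 0 only for an almost everywhere zero integrand, whereas a
  Bochner integral could be 0 by default for a non-integrable remainder.\<close>

lemma remainder_nn_integral_zero_iff:
  "(\<integral>\<^sup>+x\<in>{0<..}. ennreal (x powr (- (\<sigma> * p) + 1) * (cmod (f x - (p / (2 * x)) *\<^sub>R F x))\<^sup>2) \<partial>lebesgue) = 0
    \<longleftrightarrow> (\<exists>c. \<forall>x>0. F x = c * of_real (x powr (\<sigma> * p / 2)))"
proof -
  have "(\<integral>\<^sup>+x\<in>{0<..}. ennreal (x powr (- (\<sigma> * p) + 1) * (cmod (f x - (p / (2 * x)) *\<^sub>R F x))\<^sup>2) \<partial>lebesgue)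
      = (\<integral>\<^sup>+x. ennreal (x * (cmod (indicat_real {0<..} x *\<^sub>R k x))\<^sup>2) \<partial>lebesgue)"
    by (intro nn_integral_cong) (auto simp: indicator_def remainder_eq[simplified])
  also have "\<dots> = 0 \<longleftrightarrow> (AE x in lebesgue. ennreal (x * (cmod (indicat_real {0<..} x *\<^sub>R k x))\<^sup>2) = 0)"
  proof (rule nn_integral_0_iff_AE)
    have "(\<lambda>x. indicat_real {0<..} x *\<^sub>R k x) \<in> borel_measurable lebesgue"
      using k_measurable by (simp only: set_borel_measurable_def)
    moreover have "(\<lambda>x::real. x) \<in> borel_measurable lebesgue" by (intro measurable_completion) simp
    ultimately show "(\<lambda>x. ennreal (x * (cmod (indicat_real {0<..} x *\<^sub>R k x))\<^sup>2)) \<in> borel_measurable lebesgue"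
      by measurable
  qed
  also have "\<dots> \<longleftrightarrow> (AE x in lebesgue. 0 < x \<longrightarrow> k x = 0)"
    by (intro AE_cong) (auto simp: indicator_def ennreal_eq_0_iff mult_le_0_iff)
  finally show ?thesis by (simp only: remainder_AE_zero_iff)
qed

text \<open>Here \<open>H\<close> is the constant \<open>c\<close>, so the weighted average is a
  nonzero multiple of \<open>1 / x\<close>, which diverges already at infinity.\<close>

lemma extremal_average:
  assumes c: "c \<noteq> 0" "\<And>x. 0 < x \<Longrightarrow> F x = c * of_real (x powr (\<sigma> * p / 2))"
  shows "\<forall>x>0. x powr (- (\<sigma> * p) + 1) * (cmod ((1 / x) *\<^sub>R F x))\<^sup>2 = (cmod c)\<^sup>2 * x powr (-1)"
    and "\<not> set_integrable lebesgue {0<..} (\<lambda>x. x powr (- (\<sigma> * p) + 1) * (cmod ((1 / x) *\<^sub>R F x))\<^sup>2)"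
    and "(\<integral>\<^sup>+x\<in>{0<..}. ennreal (x powr (- (\<sigma> * p) + 1) * (cmod ((1 / x) *\<^sub>R F x))\<^sup>2) \<partial>lebesgue) = \<infinity>"
proof -
  have H: "H x = c" if "0 < x" for x
    using that c by (simp add: H_def scaleR_conv_of_real flip: of_real_mult powr_add)
  have eq: "x powr (- (\<sigma> * p) + 1) * (cmod ((1 / x) *\<^sub>R F x))\<^sup>2 = (cmod c)\<^sup>2 * (1 / x)" if "0 < x" for x
    using average_eq[OF that] H[OF that] by simp
  then show "\<forall>x>0. x powr (- (\<sigma> * p) + 1) * (cmod ((1 / x) *\<^sub>R F x))\<^sup>2 = (cmod c)\<^sup>2 * x powr (-1)"
    by (simp add: powr_minus_divide)
  have not_int: "\<not> set_integrable lebesgue {0<..} (\<lambda>x. (cmod c)\<^sup>2 * (1 / x))"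
  proof
    assume "set_integrable lebesgue {0<..} (\<lambda>x. (cmod c)\<^sup>2 * (1 / x))"
    then have "set_integrable lebesgue {0<..} (\<lambda>x::real. 1 / x)"
      using c(1) by (subst (asm) set_integrable_mult_right_iff) auto
    then have "set_integrable lebesgue {1..} (\<lambda>x::real. 1 / x)"
      by (rule set_integrable_subset) auto
    then show False using not_set_integrable_inverse_at_top[of 1] by simp
  qed
  moreover have "set_integrable lebesgue {0<..} (\<lambda>x. x powr (- (\<sigma> * p) + 1) * (cmod ((1 / x) *\<^sub>R F x))\<^sup>2)
      = set_integrable lebesgue {0<..} (\<lambda>x. (cmod c)\<^sup>2 * (1 / x))"
    by (rule set_integrable_cong) (simp_all only: greaterThan_iff eq)
  ultimately show "\<not> set_integrable lebesgue {0<..} (\<lambda>x. x powr (- (\<sigma> * p) + 1) * (cmod ((1 / x) *\<^sub>R F x))\<^sup>2)"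
    by simp
  have "(\<integral>\<^sup>+x\<in>{0<..}. ennreal (x powr (- (\<sigma> * p) + 1) * (cmod ((1 / x) *\<^sub>R F x))\<^sup>2) \<partial>lebesgue)
      = (\<integral>\<^sup>+x. ennreal (norm (indicat_real {0<..} x *\<^sub>R ((cmod c)\<^sup>2 * (1 / x)))) \<partial>lebesgue)"
  proof (rule nn_integral_cong)
    fix x :: real
    show "ennreal (x powr (- (\<sigma> * p) + 1) * (cmod ((1 / x) *\<^sub>R F x))\<^sup>2) * indicator {0<..} x
        = ennreal (norm (indicat_real {0<..} x *\<^sub>R ((cmod c)\<^sup>2 * (1 / x))))"
    proof (cases "0 < x")
      case True
      then show ?thesis unfolding eq[OF True] by simp
    qed simp
  qed
  \<comment> \<open>For a measurable function, failure of integrability means exactly that the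
    nonnegative integral of its norm is infinite.\<close>
  moreover have "(\<lambda>x. indicat_real {0<..} x *\<^sub>R ((cmod c)\<^sup>2 * (1 / x))) \<in> borel_measurable lebesgue"
    by (intro measurable_completion) simp
  ultimately show "(\<integral>\<^sup>+x\<in>{0<..}. ennreal (x powr (- (\<sigma> * p) + 1) * (cmod ((1 / x) *\<^sub>R F x))\<^sup>2) \<partial>lebesgue) = \<infinity>"
    using not_int unfolding set_integrable_def integrable_iff_bounded
    by (simp only: infinity_ennreal_def simp_thms less_top[symmetric])
qed

text \<open>Almost everywhere the derivative of \<open>H\<close> is
  \<open>\<sigma> *\<^sub>R k x\<close>, which has the norm of \<open>k x\<close>. Completeness of
  Lebesgue measure carries measurability over to the derivative.\<close>

lemma vector_derivative_energy:
  assumes rem: "set_integrable lebesgue {0<..} (\<lambda>x. x * (cmod (k x))\<^sup>2)"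
  shows "set_integrable lebesgue {0<..} (\<lambda>x. x * (cmod (vector_derivative H (at x)))\<^sup>2)"
    and "(LINT x:{0<..}|lebesgue. x * (cmod (vector_derivative H (at x)))\<^sup>2)
      = (LINT x:{0<..}|lebesgue. x * (cmod (k x))\<^sup>2)"
proof -
  have "cmod (\<sigma> *\<^sub>R k x) = cmod (k x)" for x using \<sigma> by auto
  then have eq: "AE x in lebesgue. indicat_real {0<..} x *\<^sub>R (x * (cmod (k x))\<^sup>2)
      = indicat_real {0<..} x *\<^sub>R (x * (cmod (vector_derivative H (at x)))\<^sup>2)"
    using has_derivative_H
    by (auto elim!: eventually_mono simp: indicator_def dest!: vector_derivative_at)
  have meas: "(\<lambda>x. indicat_real {0<..} x *\<^sub>R (x * (cmod (k x))\<^sup>2)) \<in> borel_measurable lebesgue"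
    using rem unfolding set_integrable_def by (rule borel_measurable_integrable)
  note meas' = borel_measurable_AE[OF meas eq]
  show "set_integrable lebesgue {0<..} (\<lambda>x. x * (cmod (vector_derivative H (at x)))\<^sup>2)"
    using integrable_cong_AE[OF meas meas' eq] rem unfolding set_integrable_def by blast
  show "(LINT x:{0<..}|lebesgue. x * (cmod (vector_derivative H (at x)))\<^sup>2)
      = (LINT x:{0<..}|lebesgue. x * (cmod (k x))\<^sup>2)"
    using integral_cong_AE[OF meas meas' eq] unfolding set_lebesgue_integral_def by (rule sym)
qed

text \<open>The growth bound on \<open>F\<close> says that \<open>H\<close> is bounded by
  \<open>K\<close>, as the integrated identity requires. The results for \<open>H\<close> and
  \<open>k\<close> are translated back to \<open>f\<close> and \<open>F\<close>, ready for both
  signs \<sigma>.\<close>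

lemma hardy_equalities:
  assumes W: "set_integrable lebesgue {0<..} (\<lambda>x. x powr (- (\<sigma> * p) + 1) * (cmod (f x))\<^sup>2)"
    and K: "\<And>x. 0 < x \<Longrightarrow> cmod (F x) \<le> K * x powr (\<sigma> * p / 2)"
  shows
    "set_integrable lebesgue {0<..} (\<lambda>x. x powr (- (\<sigma> * p) + 1) * (cmod ((1 / x) *\<^sub>R F x))\<^sup>2) \<and>
     set_integrable lebesgue {0<..} (\<lambda>x. x powr (- (\<sigma> * p) + 1) * (cmod (f x - (p / (2 * x)) *\<^sub>R F x))\<^sup>2) \<and>
     (AE x in lebesgue. 0 < x \<longrightarrow> (\<lambda>t. t powr (- (\<sigma> * p) / 2) *\<^sub>R F t) differentiable (at x)) \<and>
     set_integrable lebesgue {0<..} (\<lambda>x. x * (cmod (vector_derivative (\<lambda>t. t powr (- (\<sigma> * p) / 2) *\<^sub>R F t) (at x)))\<^sup>2) \<and>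
     (p / 2)\<^sup>2 * (LINT x:{0<..}|lebesgue. x powr (- (\<sigma> * p) + 1) * (cmod ((1 / x) *\<^sub>R F x))\<^sup>2)
       = (LINT x:{0<..}|lebesgue. x powr (- (\<sigma> * p) + 1) * (cmod (f x))\<^sup>2)
         - (LINT x:{0<..}|lebesgue. x powr (- (\<sigma> * p) + 1) * (cmod (f x - (p / (2 * x)) *\<^sub>R F x))\<^sup>2) \<and>
     (LINT x:{0<..}|lebesgue. x powr (- (\<sigma> * p) + 1) * (cmod (f x))\<^sup>2)
         - (LINT x:{0<..}|lebesgue. x powr (- (\<sigma> * p) + 1) * (cmod (f x - (p / (2 * x)) *\<^sub>R F x))\<^sup>2)
       = (LINT x:{0<..}|lebesgue. x powr (- (\<sigma> * p) + 1) * (cmod (f x))\<^sup>2)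
         - (LINT x:{0<..}|lebesgue. x * (cmod (vector_derivative (\<lambda>t. t powr (- (\<sigma> * p) / 2) *\<^sub>R F t) (at x)))\<^sup>2) \<and>
     ((LINT x:{0<..}|lebesgue. x powr (- (\<sigma> * p) + 1) * (cmod (f x - (p / (2 * x)) *\<^sub>R F x))\<^sup>2) = 0
       \<longleftrightarrow> (\<exists>c. \<forall>x>0. F x = c * of_real (x powr (\<sigma> * p / 2))))"
proof -
  have "cmod (H x) \<le> K" if "0 < x" for x
  proof -
    have "cmod (H x) = x powr (- (\<sigma> * p) / 2) * cmod (F x)" by (simp add: H_def)
    also have "\<dots> \<le> x powr (- (\<sigma> * p) / 2) * (K * x powr (\<sigma> * p / 2))"
      by (intro mult_left_mono K that) simp
    also have "\<dots> = K * (x powr (- (\<sigma> * p) / 2) * x powr (\<sigma> * p / 2))" by simp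
    also have "\<dots> = K" using that by (simp flip: powr_add)
    finally show ?thesis .
  qed
  note * = integrable_average[OF W this] integrable_remainder[OF W this] hardy_identity[OF W this]
  have H_eq: "(\<lambda>t. t powr (- (\<sigma> * p) / 2) *\<^sub>R F t) = H" by (simp add: H_def fun_eq_iff)
  let ?R = "\<lambda>x. x powr (- (\<sigma> * p) + 1) * (cmod (f x - (p / (2 * x)) *\<^sub>R F x))\<^sup>2"
  let ?A = "\<lambda>x. x powr (- (\<sigma> * p) + 1) * (cmod ((1 / x) *\<^sub>R F x))\<^sup>2"
  have A: "set_integrable lebesgue {0<..} ?A"
    "(LINT x:{0<..}|lebesgue. ?A x) = (LINT x:{0<..}|lebesgue. (cmod (H x))\<^sup>2 / x)"
  proof -
    have "set_integrable lebesgue {0<..} ?A = set_integrable lebesgue {0<..} (\<lambda>x. (cmod (H x))\<^sup>2 / x)"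
      by (rule set_integrable_cong) (simp_all only: greaterThan_iff average_eq)
    with *(1) show "set_integrable lebesgue {0<..} ?A" by blast
    show "(LINT x:{0<..}|lebesgue. ?A x) = (LINT x:{0<..}|lebesgue. (cmod (H x))\<^sup>2 / x)"
      by (rule set_lebesgue_integral_cong, simp, intro allI impI, rule average_eq, simp)
  qed
  have R: "set_integrable lebesgue {0<..} ?R"
    "(LINT x:{0<..}|lebesgue. ?R x) = (LINT x:{0<..}|lebesgue. x * (cmod (k x))\<^sup>2)"
  proof -
    have "set_integrable lebesgue {0<..} ?R = set_integrable lebesgue {0<..} (\<lambda>x. x * (cmod (k x))\<^sup>2)"
      by (rule set_integrable_cong) (simp_all only: greaterThan_iff remainder_eq)
    with *(2) show "set_integrable lebesgue {0<..} ?R" by blast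
    show "(LINT x:{0<..}|lebesgue. ?R x) = (LINT x:{0<..}|lebesgue. x * (cmod (k x))\<^sup>2)"
      by (rule set_lebesgue_integral_cong, simp, intro allI impI, rule remainder_eq, simp)
  qed
  have diff: "AE x in lebesgue. 0 < x \<longrightarrow> H differentiable (at x)"
    using has_derivative_H by (auto elim!: eventually_mono intro: differentiableI_vector)
  \<comment> \<open>Integrability of the remainder rules out the default value 0, so a vanishing
    Bochner integral forces a vanishing integrand almost everywhere.\<close>
  have "(LINT x:{0<..}|lebesgue. x * (cmod (k x))\<^sup>2) = 0
      \<longleftrightarrow> (AE x in lebesgue. indicat_real {0<..} x *\<^sub>R (x * (cmod (k x))\<^sup>2) = 0)"
    using *(2) unfolding set_lebesgue_integral_def set_integrable_def
    by (intro integral_nonneg_eq_0_iff_AE) (auto simp: indicator_def)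
  also have "\<dots> \<longleftrightarrow> (AE x in lebesgue. 0 < x \<longrightarrow> k x = 0)"
    by (intro AE_cong) (auto simp: indicator_def)
  finally have "(LINT x:{0<..}|lebesgue. x * (cmod (k x))\<^sup>2) = 0
      \<longleftrightarrow> (\<exists>c. \<forall>x>0. F x = c * of_real (x powr (\<sigma> * p / 2)))"
    by (simp only: remainder_AE_zero_iff)
  then show ?thesis
    unfolding H_eq A(2) R(2) using A(1) R(1) diff vector_derivative_energy[OF *(2)] *(3) by simp
qed

text \<open>Nonnegative integrals keep their meaning when the weighted norm of \<open>f\<close> is
  infinite, as it is for the extremal functions with nonzero \<open>c\<close>.\<close>

lemma hardy_extremal:
  "((\<integral>\<^sup>+x\<in>{0<..}. ennreal (x powr (- (\<sigma> * p) + 1) * (cmod (f x - (p / (2 * x)) *\<^sub>R F x))\<^sup>2) \<partial>lebesgue) = 0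
      \<longleftrightarrow> (\<exists>c. \<forall>x>0. F x = c * of_real (x powr (\<sigma> * p / 2)))) \<and>
   (\<forall>c. c \<noteq> 0 \<and> (\<forall>x>0. F x = c * of_real (x powr (\<sigma> * p / 2))) \<longrightarrow>
     (\<forall>x>0. x powr (- (\<sigma> * p) + 1) * (cmod ((1 / x) *\<^sub>R F x))\<^sup>2 = (cmod c)\<^sup>2 * x powr (-1)) \<and>
     \<not> set_integrable lebesgue {0<..} (\<lambda>x. x powr (- (\<sigma> * p) + 1) * (cmod ((1 / x) *\<^sub>R F x))\<^sup>2) \<and>
     (\<integral>\<^sup>+x\<in>{0<..}. ennreal (x powr (- (\<sigma> * p) + 1) * (cmod ((1 / x) *\<^sub>R F x))\<^sup>2) \<partial>lebesgue) = \<infinity>)"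
  by (intro conjI[OF remainder_nn_integral_zero_iff] allI impI; elim conjE)
    (intro conjI extremal_average; blast)

end

section \<open>The two Hardy operators\<close>

lemma AE_lebesgue_neq: "AE x in lebesgue. x \<noteq> (c::real)"
  by (intro AE_completion AE_lborel_singleton)

lemma lebesgue_primitive_int_from_zero:
  assumes f: "\<And>x. 0 < x \<Longrightarrow> set_integrable lebesgue {0<..<x} f"
  shows "lebesgue_primitive f (int_from_zero f)"
  unfolding lebesgue_primitive_def
proof (intro allI impI conjI)
  fix a b :: real assume ab: "0 < a" "a \<le> b"
  \<comment> \<open>\<open>b + 1\<close> instead of \<open>b\<close>, since the open interval up to
    \<open>b\<close> misses the end point.\<close>
  have "{a..b} \<subseteq> {0<..<b + 1}" using ab by auto
  then show int: "set_integrable lebesgue {a..b} f"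
    using ab by (intro set_integrable_subset[OF f[of "b + 1"]]) auto
  then have int': "set_integrable lebesgue {a..<b} f"
    by (rule set_integrable_subset) auto
  have split: "{0<..<b} = {0<..<a} \<union> {a..<b}" using ab by auto
  have "int_from_zero f b = int_from_zero f a + (LINT y:{a..<b}|lebesgue. f y)"
    unfolding int_from_zero_def split by (rule set_integral_Un[OF _ f[OF ab(1)] int']) auto
  moreover have "(LINT y:{a..<b}|lebesgue. f y) = (LINT y:{a..b}|lebesgue. f y)"
    using int int' AE_lebesgue_neq[of b]
    by (intro set_integral_cong_set)
      (auto simp: set_integrable_def set_borel_measurable_def elim!: eventually_mono)
  ultimately show "int_from_zero f b - int_from_zero f a = (LINT y:{a..b}|lebesgue. f y)" by simp
qed

text \<open>The domain \<open>{x<..}\<close> shrinks as \<open>x\<close> grows, hence the minus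
  sign, which is the case \<sigma> = -1.\<close>

lemma lebesgue_primitive_int_to_infinity:
  assumes f: "\<And>x. 0 < x \<Longrightarrow> set_integrable lebesgue {x<..} f"
  shows "lebesgue_primitive f (\<lambda>x. - 1 *\<^sub>R int_to_infinity f x)"
  unfolding lebesgue_primitive_def
proof (intro allI impI conjI)
  fix a b :: real assume ab: "0 < a" "a \<le> b"
  \<comment> \<open>\<open>{a<..}\<close> would miss the end point \<open>a\<close>.\<close>
  have "{a..b} \<subseteq> {a / 2<..}" using ab by auto
  then show int: "set_integrable lebesgue {a..b} f"
    using ab by (intro set_integrable_subset[OF f[of "a / 2"]]) auto
  then have int': "set_integrable lebesgue {a<..b} f"
    by (rule set_integrable_subset) auto
  have "0 < b" using ab by simp
  have split: "{a<..} = {a<..b} \<union> {b<..}" using ab by auto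
  have "int_to_infinity f a = (LINT y:{a<..b}|lebesgue. f y) + int_to_infinity f b"
    unfolding int_to_infinity_def split by (rule set_integral_Un[OF _ int' f[OF \<open>0 < b\<close>]]) auto
  moreover have "(LINT y:{a<..b}|lebesgue. f y) = (LINT y:{a..b}|lebesgue. f y)"
    using int int' AE_lebesgue_neq[of a]
    by (intro set_integral_cong_set)
      (auto simp: set_integrable_def set_borel_measurable_def elim!: eventually_mono)
  ultimately show "- 1 *\<^sub>R int_to_infinity f b - - 1 *\<^sub>R int_to_infinity f a = (LINT y:{a..b}|lebesgue. f y)"
    by simp
qed

text \<open>The weighted bound with \<open>\<alpha> = p\<close>, \<open>I = x powr p / p\<close> and
  \<open>s = x powr (p / 2)\<close>: both of its terms then scale like
  \<open>x powr (p / 2)\<close>, which is the rate that keeps \<open>H\<close> bounded.\<close>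

lemma int_from_zero_bound:
  assumes p: "0 < p" and f: "set_borel_measurable lebesgue {0<..} f"
    and W: "set_integrable lebesgue {0<..} (\<lambda>y. y powr (- p + 1) * (cmod (f y))\<^sup>2)" and x: "0 < x"
  shows "set_integrable lebesgue {0<..<x} f"
    and "cmod (int_from_zero f x)
      \<le> ((LINT y:{0<..}|lebesgue. y powr (- p + 1) * (cmod (f y))\<^sup>2) + 1 / p) / 2 * x powr (p / 2)"
proof -
  have hi: "((\<lambda>y. y powr (p - 1)) has_integral (x powr p / p)) {0..x}"
    using has_integral_powr_from_0[of "p - 1" x] p x by simp
  have w: "set_integrable lebesgue {0..x} (\<lambda>y. y powr (p - 1))"
    using hi by (intro nonnegative_absolutely_integrable_1) (auto simp: integrable_on_def)
  have w': "(LINT y:{0..x}|lebesgue. y powr (p - 1)) \<le> x powr p / p"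
    using set_lebesgue_integral_eq_integral(2)[OF w] hi by (simp add: integral_unique)
  have S: "{0<..<x} \<subseteq> {0<..}" "{0<..<x} \<in> sets lebesgue" "{0<..<x} \<subseteq> {0..x}" by auto
  have s: "0 < x powr (p / 2)" using x by simp
  note * = weighted_integrable[OF f W S w w' s]
  show "set_integrable lebesgue {0<..<x} f" by (rule *(1))
  have "x powr p = x powr (p / 2) * x powr (p / 2)" by (simp flip: powr_add)
  with *(2) show "cmod (int_from_zero f x)
      \<le> ((LINT y:{0<..}|lebesgue. y powr (- p + 1) * (cmod (f y))\<^sup>2) + 1 / p) / 2 * x powr (p / 2)"
    using s unfolding int_from_zero_def by (simp add: algebra_simps)
qed

text \<open>The mirror case \<open>\<alpha> = - p\<close>: the conjugate weight is integrable at
  infinity, and \<open>s = x powr (- p / 2)\<close> balances the terms.\<close>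

lemma int_to_infinity_bound:
  assumes p: "0 < p" and f: "set_borel_measurable lebesgue {0<..} f"
    and W: "set_integrable lebesgue {0<..} (\<lambda>y. y powr (p + 1) * (cmod (f y))\<^sup>2)" and x: "0 < x"
  shows "set_integrable lebesgue {x<..} f"
    and "cmod (int_to_infinity f x)
      \<le> ((LINT y:{0<..}|lebesgue. y powr (p + 1) * (cmod (f y))\<^sup>2) + 1 / p) / 2 * x powr (- p / 2)"
proof -
  have hi: "((\<lambda>y. y powr (- p - 1)) has_integral (x powr (- p) / p)) {x..}"
    using has_integral_powr_to_inf[of "- p - 1" x] p x by simp
  have w: "set_integrable lebesgue {x..} (\<lambda>y. y powr (- p - 1))"
    using hi by (intro nonnegative_absolutely_integrable_1) (auto simp: integrable_on_def)
  have w': "(LINT y:{x..}|lebesgue. y powr (- p - 1)) \<le> x powr (- p) / p"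
    using set_lebesgue_integral_eq_integral(2)[OF w] hi by (simp add: integral_unique)
  have S: "{x<..} \<subseteq> {0<..}" "{x<..} \<in> sets lebesgue" "{x<..} \<subseteq> {x..}" using x by auto
  have s: "0 < x powr (- p / 2)" using x by simp
  note * = weighted_integrable[where \<alpha> = "- p", unfolded minus_minus, OF f W S w w' s]
  show "set_integrable lebesgue {x<..} f" by (rule *(1))
  have "x powr (- p) = x powr (- p / 2) * x powr (- p / 2)" by (simp flip: powr_add)
  with *(2) show "cmod (int_to_infinity f x)
      \<le> ((LINT y:{0<..}|lebesgue. y powr (p + 1) * (cmod (f y))\<^sup>2) + 1 / p) / 2 * x powr (- p / 2)"
    using s unfolding int_to_infinity_def by (simp add: algebra_simps)
qed

text \<open>Integrability clauses accompany the identities because non-integrable functions have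
  Bochner integral 0. The equality case is also given with the nonnegative integral, where 0 and
  infinity carry their usual meaning.\<close>

theorem theorem3:
  fixes p :: real
  assumes "p > 0"
  shows
    "((\<forall>f. locally_L1 {0<..} f \<and>
          set_integrable lebesgue {0<..} (\<lambda>x. x powr (- p + 1) * (cmod (f x))\<^sup>2) \<longrightarrow>
        (\<forall>x>0. set_integrable lebesgue {0<..<x} f) \<and>
        set_integrable lebesgue {0<..} (\<lambda>x. x powr (- p + 1) * (cmod ((1 / x) *\<^sub>R int_from_zero f x))\<^sup>2) \<and>
        set_integrable lebesgue {0<..} (\<lambda>x. x powr (- p + 1) * (cmod (f x - (p / (2 * x)) *\<^sub>R int_from_zero f x))\<^sup>2) \<and>
        (AE x in lebesgue. 0 < x \<longrightarrow>
          (\<lambda>t. t powr (- p / 2) *\<^sub>R int_from_zero f t) differentiable (at x)) \<and>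
        set_integrable lebesgue {0<..} (\<lambda>x. x * (cmod (vector_derivative (\<lambda>t. t powr (- p / 2) *\<^sub>R int_from_zero f t) (at x)))\<^sup>2) \<and>
        (p / 2)\<^sup>2 * (LINT x:{0<..}|lebesgue. x powr (- p + 1) * (cmod ((1 / x) *\<^sub>R int_from_zero f x))\<^sup>2)
          = (LINT x:{0<..}|lebesgue. x powr (- p + 1) * (cmod (f x))\<^sup>2)
            - (LINT x:{0<..}|lebesgue. x powr (- p + 1) * (cmod (f x - (p / (2 * x)) *\<^sub>R int_from_zero f x))\<^sup>2) \<and>
        (LINT x:{0<..}|lebesgue. x powr (- p + 1) * (cmod (f x))\<^sup>2)
            - (LINT x:{0<..}|lebesgue. x powr (- p + 1) * (cmod (f x - (p / (2 * x)) *\<^sub>R int_from_zero f x))\<^sup>2)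
          = (LINT x:{0<..}|lebesgue. x powr (- p + 1) * (cmod (f x))\<^sup>2)
            - (LINT x:{0<..}|lebesgue. x * (cmod (vector_derivative (\<lambda>t. t powr (- p / 2) *\<^sub>R int_from_zero f t) (at x)))\<^sup>2) \<and>
        ((LINT x:{0<..}|lebesgue. x powr (- p + 1) * (cmod (f x - (p / (2 * x)) *\<^sub>R int_from_zero f x))\<^sup>2) = 0
          \<longleftrightarrow> (\<exists>c. (\<forall>x>0. int_from_zero f x = c * of_real (x powr (p / 2)))))) \<and>
     (\<forall>f. locally_L1 {0<..} f \<and> (\<forall>x>0. set_integrable lebesgue {0<..<x} f) \<longrightarrow>
        ((\<integral>\<^sup>+x\<in>{0<..}. ennreal (x powr (- p + 1) * (cmod (f x - (p / (2 * x)) *\<^sub>R int_from_zero f x))\<^sup>2) \<partial>lebesgue) = 0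
          \<longleftrightarrow> (\<exists>c. (\<forall>x>0. int_from_zero f x = c * of_real (x powr (p / 2))))) \<and>
        (\<forall>c. c \<noteq> 0 \<and> (\<forall>x>0. int_from_zero f x = c * of_real (x powr (p / 2))) \<longrightarrow>
          (\<forall>x>0. x powr (- p + 1) * (cmod ((1 / x) *\<^sub>R int_from_zero f x))\<^sup>2
             = (cmod c)\<^sup>2 * x powr (-1)) \<and>
          \<not> set_integrable lebesgue {0<..} (\<lambda>x. x powr (- p + 1) * (cmod ((1 / x) *\<^sub>R int_from_zero f x))\<^sup>2) \<and>
          (\<integral>\<^sup>+x\<in>{0<..}. ennreal (x powr (- p + 1) * (cmod ((1 / x) *\<^sub>R int_from_zero f x))\<^sup>2) \<partial>lebesgue) = \<infinity>))) \<and>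
     ((\<forall>f. locally_L1 {0<..} f \<and>
          set_integrable lebesgue {0<..} (\<lambda>x. x powr (p + 1) * (cmod (f x))\<^sup>2) \<longrightarrow>
        (\<forall>x>0. set_integrable lebesgue {x<..} f) \<and>
        set_integrable lebesgue {0<..} (\<lambda>x. x powr (p + 1) * (cmod ((1 / x) *\<^sub>R int_to_infinity f x))\<^sup>2) \<and>
        set_integrable lebesgue {0<..} (\<lambda>x. x powr (p + 1) * (cmod (f x - (p / (2 * x)) *\<^sub>R int_to_infinity f x))\<^sup>2) \<and>
        (AE x in lebesgue. 0 < x \<longrightarrow>
          (\<lambda>t. t powr (p / 2) *\<^sub>R int_to_infinity f t) differentiable (at x)) \<and>
        set_integrable lebesgue {0<..} (\<lambda>x. x * (cmod (vector_derivative (\<lambda>t. t powr (p / 2) *\<^sub>R int_to_infinity f t) (at x)))\<^sup>2) \<and>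
        (p / 2)\<^sup>2 * (LINT x:{0<..}|lebesgue. x powr (p + 1) * (cmod ((1 / x) *\<^sub>R int_to_infinity f x))\<^sup>2)
          = (LINT x:{0<..}|lebesgue. x powr (p + 1) * (cmod (f x))\<^sup>2)
            - (LINT x:{0<..}|lebesgue. x powr (p + 1) * (cmod (f x - (p / (2 * x)) *\<^sub>R int_to_infinity f x))\<^sup>2) \<and>
        (LINT x:{0<..}|lebesgue. x powr (p + 1) * (cmod (f x))\<^sup>2)
            - (LINT x:{0<..}|lebesgue. x powr (p + 1) * (cmod (f x - (p / (2 * x)) *\<^sub>R int_to_infinity f x))\<^sup>2)
          = (LINT x:{0<..}|lebesgue. x powr (p + 1) * (cmod (f x))\<^sup>2)
            - (LINT x:{0<..}|lebesgue. x * (cmod (vector_derivative (\<lambda>t. t powr (p / 2) *\<^sub>R int_to_infinity f t) (at x)))\<^sup>2) \<and>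
        ((LINT x:{0<..}|lebesgue. x powr (p + 1) * (cmod (f x - (p / (2 * x)) *\<^sub>R int_to_infinity f x))\<^sup>2) = 0
          \<longleftrightarrow> (\<exists>c. (\<forall>x>0. int_to_infinity f x = c * of_real (x powr (- p / 2)))))) \<and>
     (\<forall>f. locally_L1 {0<..} f \<and> (\<forall>x>0. set_integrable lebesgue {x<..} f) \<longrightarrow>
        ((\<integral>\<^sup>+x\<in>{0<..}. ennreal (x powr (p + 1) * (cmod (f x - (p / (2 * x)) *\<^sub>R int_to_infinity f x))\<^sup>2) \<partial>lebesgue) = 0
          \<longleftrightarrow> (\<exists>c. (\<forall>x>0. int_to_infinity f x = c * of_real (x powr (- p / 2))))) \<and>
        (\<forall>c. c \<noteq> 0 \<and> (\<forall>x>0. int_to_infinity f x = c * of_real (x powr (- p / 2))) \<longrightarrow>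
          (\<forall>x>0. x powr (p + 1) * (cmod ((1 / x) *\<^sub>R int_to_infinity f x))\<^sup>2
             = (cmod c)\<^sup>2 * x powr (-1)) \<and>
          \<not> set_integrable lebesgue {0<..} (\<lambda>x. x powr (p + 1) * (cmod ((1 / x) *\<^sub>R int_to_infinity f x))\<^sup>2) \<and>
          (\<integral>\<^sup>+x\<in>{0<..}. ennreal (x powr (p + 1) * (cmod ((1 / x) *\<^sub>R int_to_infinity f x))\<^sup>2) \<partial>lebesgue) = \<infinity>)))"
proof -
  \<comment> \<open>Part (1) is the case \<sigma> = 1 and part (2) the case \<sigma> = -1; unfolding
    the product \<open>\<sigma> * p\<close> then matches the clauses literally.\<close>
  have zero: "hardy_pair p 1 f (int_from_zero f)" if "\<And>x. 0 < x \<Longrightarrow> set_integrable lebesgue {0<..<x} f" for f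
    using assms lebesgue_primitive_int_from_zero[OF that] by unfold_locales simp_all
  have infinity: "hardy_pair p (-1) f (int_to_infinity f)" if "\<And>x. 0 < x \<Longrightarrow> set_integrable lebesgue {x<..} f" for f
    using assms lebesgue_primitive_int_to_infinity[OF that] by unfold_locales simp_all
  {
    fix f :: "real \<Rightarrow> complex"
    assume f: "locally_L1 {0<..} f"
      and W: "set_integrable lebesgue {0<..} (\<lambda>x. x powr (- p + 1) * (cmod (f x))\<^sup>2)"
    have "set_borel_measurable lebesgue {0<..} f" using f by (simp add: locally_L1_def)
    note bound = int_from_zero_bound[OF assms this W]
    have "\<forall>x>0. set_integrable lebesgue {0<..<x} f" using bound(1) by blast
    note conjI[OF this hardy_pair.hardy_equalities[OF zero[OF bound(1)], unfolded mult_1, OF _ W bound(2)]]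
  }
  note part1 = this
  {
    fix f :: "real \<Rightarrow> complex"
    assume f: "locally_L1 {0<..} f"
      and W: "set_integrable lebesgue {0<..} (\<lambda>x. x powr (p + 1) * (cmod (f x))\<^sup>2)"
    have "set_borel_measurable lebesgue {0<..} f" using f by (simp add: locally_L1_def)
    note bound = int_to_infinity_bound[OF assms this W]
    have "\<forall>x>0. set_integrable lebesgue {x<..} f" using bound(1) by blast
    note conjI[OF this hardy_pair.hardy_equalities[OF infinity[OF bound(1)],
        unfolded mult_minus1 minus_minus, OF _ W bound(2)]]
  }
  note part2 = this
  note extremal1 = hardy_pair.hardy_extremal[OF zero, unfolded mult_1]
  note extremal2 = hardy_pair.hardy_extremal[OF infinity, unfolded mult_minus1 minus_minus]
  show ?thesis
    by (intro conjI; intro allI impI; elim conjE)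
      (rule part1 extremal1 part2 extremal2; blast)+
qed

end
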